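(* The function $\mathbb{E}=\frac12(\dot\theta^\circ)^2+\mathcal{U}(\theta^\circ)$ is a first integral of the differential inclusion $\ddot\theta^\circ(t)\in-\mathcal{U}'(\theta^\circ(t))$ (a.e. $t$), i.e. $\mathbb{E}$ is constant along any solution. Moreover, if $\tilde\theta^\circ(t)$ is a $C^1$ function on an interval with $\dot{\tilde\theta}^\circ(t)\neq0$ for all $t$ in the interval, and $\mathbb{E}$ is constant along $\tilde\theta^\circ$, then $\tilde\theta^\circ$ belongs to $W^2_\infty$ on the interval and is a solution of the inclusion.
   Context: Let $\Omega\subset\mathbb{R}^2$ be convex compact with $0\in\operatorname{int}\Omega$. For a convex compact $K\subset\mathbb{R}^2$ with $0$ in its interior and area $\mathbb{S}_K$, and $\psi\in[0,2\mathbb{S}_K)$, $(\cos_K\psi,\sin_K\psi)$ is the point of $\partial K$ such that the sector of $K$ between the positive first-coordinate axis and the ray to this point (counterclockwise) has area $\psi/2$; extended $2\mathbb{S}_K$-periodically. $\Omega^\circ=\{(p,q):px+qy\le 1\ \forall(x,y)\in\Omega\}$. $\theta\leftrightarrow\theta^\circ$ iff $\cos_\Omega\theta\cos_{\Omega^\circ}\theta^\circ+\sin_\Omega\theta\sin_{\Omega^\circ}\theta^\circ=1$. Let $f(p,q)$ be a sufficiently smooth function, $\mathcal{U}(\theta^\circ)=f(\cos_{\Omega^\circ}\theta^\circ,\sin_{\Omega^\circ}\theta^\circ)$, and with $Q=(\cos_{\Omega^\circ}\theta^\circ,\sin_{\Omega^\circ}\theta^\circ)$, $\mathcal{U}'(\theta^\circ)=\{-f_p(Q)\sin_\Omega\theta+f_q(Q)\cos_\Omega\theta:\theta\leftrightarrow\theta^\circ\}$.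 A solution of the inclusion is a $W^2_\infty$ function (derivative Lipschitz) with $\ddot\theta^\circ(t)\in-\mathcal{U}'(\theta^\circ(t))$ for a.e. $t$; when $\mathcal{U}'$ is a singleton $\{a\}$ one writes $\mathcal{U}'=a$. *)

theory Defs
  imports "HOL-Analysis.Analysis"
begin

definition area :: "(real \<times> real) set \<Rightarrow> real" where
  "area K = measure lebesgue K"

definition sector :: "(real \<times> real) set \<Rightarrow> real \<Rightarrow> (real \<times> real) set" where
  "sector K a = K \<inter> {r *\<^sub>R (cos s, sin s) | r s. 0 \<le> r \<and> 0 \<le> s \<and> s \<le> a}"

definition radial :: "(real \<times> real) set \<Rightarrow> real \<Rightarrow> real" where
  "radial K a = Sup {r. 0 \<le> r \<and> r *\<^sub>R (cos a, sin a) \<in> K}"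

text \<open>For psi in [0, 2 S_K): the polar angle of the ray cutting off a sector of area psi/2.\<close>
definition gangle :: "(real \<times> real) set \<Rightarrow> real \<Rightarrow> real" where
  "gangle K \<psi> = (THE a. 0 \<le> a \<and> a < 2 * pi \<and> area (sector K a) = \<psi> / 2)"

definition gpoint :: "(real \<times> real) set \<Rightarrow> real \<Rightarrow> real \<times> real" where
  "gpoint K \<psi> =
     (let P = 2 * area K;
          \<psi>' = \<psi> - P * of_int \<lfloor>\<psi> / P\<rfloor>;
          a = gangle K \<psi>'
      in radial K a *\<^sub>R (cos a, sin a))"

definition gcos :: "(real \<times> real) set \<Rightarrow> real \<Rightarrow> real" where
  "gcos K \<psi> = fst (gpoint K \<psi>)"

definition gsin :: "(real \<times> real) set \<Rightarrow> real \<Rightarrow> real" where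
  "gsin K \<psi> = snd (gpoint K \<psi>)"

definition polar :: "(real \<times> real) set \<Rightarrow> (real \<times> real) set" where
  "polar \<Omega> = {(p, q). \<forall>(x, y) \<in> \<Omega>. p * x + q * y \<le> 1}"

definition corr :: "(real \<times> real) set \<Rightarrow> real \<Rightarrow> real \<Rightarrow> bool" where
  "corr \<Omega> \<theta> \<theta>\<^sub>p \<longleftrightarrow>
     gcos \<Omega> \<theta> * gcos (polar \<Omega>) \<theta>\<^sub>p + gsin \<Omega> \<theta> * gsin (polar \<Omega>) \<theta>\<^sub>p = 1"

definition Upot :: "(real \<times> real) set \<Rightarrow> (real \<times> real \<Rightarrow> real) \<Rightarrow> real \<Rightarrow> real" where
  "Upot \<Omega> f \<theta>\<^sub>p = f (gcos (polar \<Omega>) \<theta>\<^sub>p, gsin (polar \<Omega>) \<theta>\<^sub>p)"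

text \<open>Set-valued derivative U'(theta-polar); fp, fq are the partial derivatives of f.\<close>
definition Uder :: "(real \<times> real) set \<Rightarrow> (real \<times> real \<Rightarrow> real) \<Rightarrow> (real \<times> real \<Rightarrow> real)
    \<Rightarrow> real \<Rightarrow> real set" where
  "Uder \<Omega> fp fq \<theta>\<^sub>p =
     (let Q = (gcos (polar \<Omega>) \<theta>\<^sub>p, gsin (polar \<Omega>) \<theta>\<^sub>p)
      in {- fp Q * gsin \<Omega> \<theta> + fq Q * gcos \<Omega> \<theta> | \<theta>. corr \<Omega> \<theta> \<theta>\<^sub>p})"

definition W2inf_on :: "real set \<Rightarrow> (real \<Rightarrow> real) \<Rightarrow> bool" where
  "W2inf_on I x \<longleftrightarrow>
     (\<exists>x'. (\<forall>t\<in>I. (x has_real_derivative x' t) (at t within I)) \<and> (\<exists>L. L-lipschitz_on I x'))"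

definition is_solution ::
    "(real \<times> real) set \<Rightarrow> (real \<times> real \<Rightarrow> real) \<Rightarrow> (real \<times> real \<Rightarrow> real)
     \<Rightarrow> real set \<Rightarrow> (real \<Rightarrow> real) \<Rightarrow> bool" where
  "is_solution \<Omega> fp fq I x \<longleftrightarrow>
     (\<exists>x'. (\<forall>t\<in>I. (x has_real_derivative x' t) (at t within I)) \<and> (\<exists>L. L-lipschitz_on I x') \<and>
        (AE t in lebesgue. t \<in> I \<longrightarrow>
           (\<exists>a. (x' has_real_derivative a) (at t within I) \<and> a \<in> uminus ` Uder \<Omega> fp fq (x t))))"

end

theory Submission
  imports Defs
begin

text \<open>
  Let \<open>h\<close> be the support function of \<open>\<Omega>\<close> and \<open>\<eta> a = h (cos a, sin a)\<close>. The boundary of the polar body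
  is \<open>a \<mapsto> (cos a, sin a) / \<eta> a\<close>, and by squeezing thin sectors between two triangles twice the area
  swept up to angle \<open>a\<close> has derivative \<open>1 / (\<eta> a)\<^sup>2\<close>. Inverting this function turns the area
  parametrisation into a Lipschitz curve. If the direction \<open>a\<close> has a unique maximiser \<open>P \<in> \<Omega>\<close>, then
  \<open>\<eta>\<close> is differentiable at \<open>a\<close> (Danskin) and the curve has velocity \<open>(- P\<^sub>2, P\<^sub>1)\<close>; the other
  directions correspond to the segments in the boundary of \<open>\<Omega>\<close>, so there are only countably many.
  Hence the potential is Lipschitz, and off a countable set it is differentiable with its derivative as
  the only element of the set-valued derivative.

  Along a solution the energy is locally Lipschitz. Its derivative vanishes almost everywhere: at times
  with zero velocity because the potential is Lipschitz, and at times with nonzero velocity because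
  the exceptional values are then attained only countably often. Conversely, constant energy and a
  velocity without zeros express the velocity as a square root of a Lipschitz function.
\<close>

section \<open>Energy of a Lipschitz potential on the line\<close>

text \<open>Near a point outside \<open>N\<close> an increment of \<open>g\<close> costs at most
  \<open>e\<close> times the length. Near a point of \<open>N\<close> it costs up to
  \<open>L\<close> times the length, but there the length lies in an open set of measure at most
  \<open>e\<close>.\<close>

lemma lipschitz_on_AE_zero_deriv_bound:
  fixes g :: "real \<Rightarrow> real"
  assumes "a \<le> b" and lip: "L-lipschitz_on {a..b} g" and N: "negligible N" and "0 < e"
    and der: "\<And>t. t \<in> {a..b} - N \<Longrightarrow> (g has_real_derivative 0) (at t within {a..b})"
  shows "\<bar>g b - g a\<bar> \<le> e * (b - a) + L * e"
proof -
  have L: "0 \<le> L" using lip by (rule lipschitz_on_nonneg)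
  \<comment> \<open>On a small open neighbourhood of \<open>N\<close> the Lipschitz constant controls the increments of \<open>g\<close>.\<close>
  obtain T where T: "open T" "N \<subseteq> T" "(T - N) \<in> lmeasurable" "emeasure lebesgue (T - N) < ennreal e"
    using sets_lebesgue_outer_open[OF negligible_imp_sets[OF N] \<open>0 < e\<close>] by blast
  have Tm: "T \<in> lmeasurable"
    using fmeasurable.Un[OF T(3) negligible_imp_measurable[OF N]] \<open>N \<subseteq> T\<close> by (simp add: Un_absorb2)
  have "measure lebesgue T = measure lebesgue (T - N)"
    using Tm N by (simp add: measure_Diff_null_set negligible_iff_null_sets fmeasurableD)
  also have "\<dots> \<le> e"
    using T(3,4) \<open>0 < e\<close> by (simp add: emeasure_eq_measure2 ennreal_less_iff)
  finally have Te: "measure lebesgue T \<le> e" .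
  \<comment> \<open>Half-open intervals make \<open>m\<close> exactly additive under
    concatenation.\<close>
  define m where "m u v = measure lebesgue (T \<inter> {u<..v})" for u v
  \<comment> \<open>\<open>P\<close> is vacuous for intervals that leave \<open>{a..b}\<close>,
    which settles short intervals around an end point. It follows by bisection: a bound that adds up
    over adjacent intervals holds globally once it holds on all short intervals around each
    point.\<close>
  define P where "P u v \<longleftrightarrow> (a \<le> u \<and> v \<le> b \<longrightarrow> \<bar>g v - g u\<bar> \<le> e * (v - u) + L * m u v)" for u v
  have ms: "T \<inter> {u<..v} \<in> lmeasurable" for u v
    using Tm by (intro fmeasurable_Int_fmeasurable) auto
  have "P a b"
    using \<open>a \<le> b\<close>
  proof (induction a b rule: Bolzano)
    case (trans u v w)
    have "m u w = m u v + m v w"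
    proof -
      have "T \<inter> {u<..w} = (T \<inter> {u<..v}) \<union> (T \<inter> {v<..w})" using trans by auto
      moreover have dj: "T \<inter> {u<..v} \<inter> (T \<inter> {v<..w}) = {}" by auto
      ultimately show ?thesis unfolding m_def
        by (metis measure_Un3[OF ms ms] measure_empty diff_zero)
    qed
    then have "L * m u w = L * m u v + L * m v w" by (simp add: algebra_simps)
    moreover have "e * (w - u) = e * (v - u) + e * (w - v)" by (simp add: algebra_simps)
    moreover have "\<bar>g w - g u\<bar> \<le> \<bar>g v - g u\<bar> + \<bar>g w - g v\<bar>" by linarith
    ultimately show ?case using trans(1-4) unfolding P_def by linarith
  next
    case (local x)
    show ?case
    proof (cases "x \<in> N")
      case True
      then obtain d where d: "d > 0" "ball x d \<subseteq> T" using T(1,2) open_contains_ball by blast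
      have "P u v" if "u \<le> x" "x \<le> v" "v - u < d" for u v
      proof -
        have "{u<..v} \<subseteq> ball x d" using that by (auto simp: dist_real_def)
        then have "T \<inter> {u<..v} = {u<..v}" using d by auto
        then have "m u v = v - u" using that by (simp add: m_def)
        moreover have "\<bar>g v - g u\<bar> \<le> L * (v - u)" if "a \<le> u" "v \<le> b"
          using lipschitz_onD[OF lip, of v u] that \<open>u \<le> x\<close> \<open>x \<le> v\<close> by (auto simp: dist_real_def)
        moreover have "0 \<le> e * (v - u)" using \<open>0 < e\<close> that by simp
        ultimately show ?thesis unfolding P_def by (metis add_increasing)
      qed
      then show ?thesis using d by blast
    next
      case False
      then have "(g has_real_derivative 0) (at x within {a..b})" using der local by auto
      then have "(g has_derivative (\<lambda>h. 0)) (at x within {a..b})"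
        by (simp add: has_field_derivative_def lambda_zero)
      then have "\<exists>d>0. \<forall>y\<in>{a..b}. norm (y - x) < d \<longrightarrow> norm (g y - g x - 0) \<le> e * norm (y - x)"
        using \<open>0 < e\<close> unfolding has_derivative_within_alt by blast
      then obtain d where d: "d > 0"
        "\<And>y. y \<in> {a..b} \<Longrightarrow> \<bar>y - x\<bar> < d \<Longrightarrow> \<bar>g y - g x\<bar> \<le> e * \<bar>y - x\<bar>"
        by auto
      have "P u v" if "u \<le> x" "x \<le> v" "v - u < d" for u v
      proof -
        have "\<bar>g v - g u\<bar> \<le> e * (v - u)" if "a \<le> u" "v \<le> b"
        proof -
          have "\<bar>g u - g x\<bar> \<le> e * (x - u)" "\<bar>g v - g x\<bar> \<le> e * (v - x)"
            using d(2)[of u] d(2)[of v] that \<open>u \<le> x\<close> \<open>x \<le> v\<close> \<open>v - u < d\<close> by auto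
          moreover have "e * (v - u) = e * (x - u) + e * (v - x)" by (simp add: algebra_simps)
          ultimately show ?thesis by linarith
        qed
        moreover have "0 \<le> L * m u v" using L by (simp add: m_def)
        ultimately show ?thesis unfolding P_def by (meson add_increasing2)
      qed
      then show ?thesis using d by blast
    qed
  qed
  moreover have "m a b \<le> e"
    unfolding m_def
    by (rule order_trans[OF measure_mono_fmeasurable[OF Int_lower1 fmeasurableD[OF ms] Tm] Te])
  then have "L * m a b \<le> L * e" using L by (rule mult_left_mono)
  ultimately show ?thesis by (simp add: P_def)
qed

lemma lipschitz_on_AE_zero_deriv_const:
  fixes g :: "real \<Rightarrow> real"
  assumes "a \<le> b" and lip: "L-lipschitz_on {a..b} g" and N: "negligible N"
    and der: "\<And>t. t \<in> {a..b} - N \<Longrightarrow> (g has_real_derivative 0) (at t within {a..b})"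
  shows "g a = g b"
proof -
  have L: "0 \<le> L" using lip by (rule lipschitz_on_nonneg)
  have "\<bar>g b - g a\<bar> \<le> 0 + e" if "e > 0" for e
  proof -
    \<comment> \<open>Scaled so that the bound of the preceding lemma is at most \<open>e\<close>;
      the summand 1 keeps the denominator positive when \<open>a = b\<close> and
      \<open>L = 0\<close>.\<close>
    define d where "d = e / (b - a + L + 1)"
    have d: "d > 0" using that L \<open>a \<le> b\<close> by (simp add: d_def)
    have "\<bar>g b - g a\<bar> \<le> d * (b - a) + L * d"
      by (rule lipschitz_on_AE_zero_deriv_bound[OF assms(1) lip N d der])
    also have "\<dots> \<le> d * (b - a + L + 1)" using d by (simp add: algebra_simps)
    also have "\<dots> = e" using L \<open>a \<le> b\<close> by (simp add: d_def)
    finally show ?thesis by simp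
  qed
  then have "\<bar>g b - g a\<bar> \<le> 0" by (rule field_le_epsilon)
  then show ?thesis by simp
qed

section \<open>Countability of the times at which a moving trajectory meets given positions\<close>

text \<open>Each point gets a member of a countable basis that contains no other point of
  \<open>S\<close>, and this assignment is injective.\<close>

lemma discrete_imp_countable:
  fixes S :: "'a::second_countable_topology set"
  assumes "discrete S"
  shows "countable S"
proof -
  have "\<exists>T. open T \<and> T \<inter> S = {t}" if "t \<in> S" for t
    using discreteD[OF assms that] by (auto simp: isolated_in_def)
  then obtain T where T: "\<And>t. t \<in> S \<Longrightarrow> open (T t) \<and> T t \<inter> S = {t}" by metis
  obtain \<B> :: "'a set set" where B: "countable \<B>" "topological_basis \<B>"
    using ex_countable_basis by blast
  have "\<exists>W\<in>\<B>. t \<in> W \<and> W \<subseteq> T t" if "t \<in> S" for t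
  proof -
    have "open (T t)" "t \<in> T t" using T[OF that] by auto
    then show ?thesis by (metis topological_basisE[OF B(2)])
  qed
  then obtain W where W: "\<And>t. t \<in> S \<Longrightarrow> W t \<in> \<B> \<and> t \<in> W t \<and> W t \<subseteq> T t" by metis
  have "inj_on W S"
  proof (rule inj_onI)
    fix s t assume "s \<in> S" "t \<in> S" "W s = W t"
    then have "s \<in> T t \<inter> S" using W[of s] W[of t] by auto
    then show "s = t" using T[OF \<open>t \<in> S\<close>] by auto
  qed
  moreover have "countable (W ` S)" using B(1) W by (meson countable_subset image_subsetI)
  ultimately show ?thesis using countable_image_inj_on by blast
qed

text \<open>At such a time the difference quotient has a nonzero limit, so the value
  \<open>c\<close> is not taken again nearby and the time is isolated.\<close>

lemma countable_noncritical_level_set: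
  fixes x :: "real \<Rightarrow> real"
  assumes "\<And>t. t \<in> I \<Longrightarrow> (x has_real_derivative x' t) (at t within I)"
  shows "countable {t\<in>I. x t = c \<and> x' t \<noteq> 0}" (is "countable ?Z")
proof -
  have "t isolated_in ?Z" if "t \<in> ?Z" for t
  proof -
    have "((\<lambda>s. (x s - x t) / (s - t)) \<longlongrightarrow> x' t) (at t within I)"
      using assms[of t] that by (simp add: has_field_derivative_iff)
    then have "eventually (\<lambda>s. (x s - x t) / (s - t) \<noteq> 0) (at t within I)"
      using that by (intro tendsto_imp_eventually_ne) auto
    then have "eventually (\<lambda>s. s \<notin> ?Z) (at t)"
      unfolding eventually_at_filter by eventually_elim (use that in auto)
    then show ?thesis using that by (simp add: isolated_in_altdef)
  qed
  then have "discrete ?Z" by (rule discreteI)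
  then show ?thesis by (rule discrete_imp_countable)
qed

lemma countable_noncritical_preimage:
  fixes x :: "real \<Rightarrow> real"
  assumes "\<And>t. t \<in> I \<Longrightarrow> (x has_real_derivative x' t) (at t within I)" "countable N"
  shows "countable {t\<in>I. x t \<in> N \<and> x' t \<noteq> 0}"
proof -
  have "{t\<in>I. x t \<in> N \<and> x' t \<noteq> 0} = (\<Union>c\<in>N. {t\<in>I. x t = c \<and> x' t \<noteq> 0})" by auto
  then show ?thesis using assms by (auto intro!: countable_UN countable_noncritical_level_set)
qed

lemma countable_imp_negligible:
  fixes S :: "'a::euclidean_space set"
  assumes "countable S"
  shows "negligible S"
  unfolding negligible_iff_null_sets
  by (rule null_sets_completionI[OF countable_imp_null_set_lborel[OF assms]])

section \<open>Conservation of energy and its converse\<close>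

text \<open>Abstracts from the plane: the geometry enters only through the Lipschitz bound on
  \<open>U\<close>, the set-valued derivative \<open>D\<close> and the countable exceptional set
  \<open>N\<close>. At almost every time the energy has derivative zero, since the acceleration is
  minus the slope of \<open>U\<close> or the velocity vanishes.\<close>

lemma energy_constant:
  fixes x x' U :: "real \<Rightarrow> real" and D :: "real \<Rightarrow> real set"
  assumes U: "M-lipschitz_on UNIV U" and N: "countable N"
    and dU: "\<And>p. p \<notin> N \<Longrightarrow> \<exists>d. D p = {d} \<and> (U has_real_derivative d) (at p)"
    and I: "is_interval I"
    and x: "\<And>t. t \<in> I \<Longrightarrow> (x has_real_derivative x' t) (at t within I)"
    and x': "L-lipschitz_on I x'"
    and ae: "AE t in lebesgue. t \<in> I \<longrightarrow>
           (\<exists>a. (x' has_real_derivative a) (at t within I) \<and> a \<in> uminus ` D (x t))"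
  shows "\<exists>c. \<forall>t\<in>I. (x' t)\<^sup>2 / 2 + U (x t) = c"
proof -
  have M: "0 \<le> M" and L: "0 \<le> L"
    by (rule lipschitz_on_nonneg[OF U] lipschitz_on_nonneg[OF x'])+
  define E where "E t = (x' t)\<^sup>2 / 2 + U (x t)" for t
  have "E s = E t" if st: "s \<in> I" "t \<in> I" "s \<le> t" for s t
  proof -
    have sub: "{s..t} \<subseteq> I" using mem_is_interval_1_I[OF I st(1,2)] by auto
    \<comment> \<open>The velocity may be unbounded on \<open>I\<close>, so the energy is shown to
      be Lipschitz only on the compact interval \<open>{s..t}\<close>, with a local bound
      \<open>B\<close> on the speed.\<close>
    have contx': "continuous_on {s..t} x'"
      using lipschitz_on_continuous_on[OF lipschitz_on_subset[OF x' sub]] .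
    then have "bounded (x' ` {s..t})" by (intro compact_imp_bounded compact_continuous_image) auto
    then obtain B where B: "B > 0" "\<And>u. u \<in> {s..t} \<Longrightarrow> \<bar>x' u\<bar> \<le> B"
      unfolding bounded_pos by auto
    have lipx: "B-lipschitz_on {s..t} x"
    proof (rule bounded_derivative_imp_lipschitz)
      show "(x has_derivative (*) (x' u)) (at u within {s..t})" if "u \<in> {s..t}" for u
        using x[of u] that sub has_field_derivative_subset[of x "x' u" u I "{s..t}"]
        by (auto simp: has_field_derivative_def)
      show "onorm ((*) (x' u)) \<le> B" if "u \<in> {s..t}" for u
        using B(2)[OF that] by (intro onorm_le) (auto simp: abs_mult mult_right_mono)
    qed (use B in auto)
    have "(B * L + M * B)-lipschitz_on {s..t} E"
    proof (rule lipschitz_onI)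
      fix u v assume uv: "u \<in> {s..t}" "v \<in> {s..t}"
      have 1: "\<bar>x' u - x' v\<bar> \<le> L * \<bar>u - v\<bar>"
        using lipschitz_onD[OF x', of u v] subsetD[OF sub uv(1)] subsetD[OF sub uv(2)]
        by (simp add: dist_real_def)
      have 2: "\<bar>x u - x v\<bar> \<le> B * \<bar>u - v\<bar>"
        using lipschitz_onD[OF lipx, of u v] uv by (auto simp: dist_real_def)
      have 3: "\<bar>U (x u) - U (x v)\<bar> \<le> M * \<bar>x u - x v\<bar>"
        using lipschitz_onD[OF U, of "x u" "x v"] by (auto simp: dist_real_def)
      have "\<bar>(x' u)\<^sup>2 / 2 - (x' v)\<^sup>2 / 2\<bar> = \<bar>x' u + x' v\<bar> / 2 * \<bar>x' u - x' v\<bar>"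
        by (simp add: power2_eq_square abs_mult[symmetric] field_simps)
      also have "\<dots> \<le> B * (L * \<bar>u - v\<bar>)"
        using B(2)[OF uv(1)] B(2)[OF uv(2)] by (intro mult_mono 1) (use B L in auto)
      finally have "\<bar>E u - E v\<bar> \<le> B * (L * \<bar>u - v\<bar>) + M * (B * \<bar>u - v\<bar>)"
        using 3 mult_left_mono[OF 2 M] unfolding E_def by linarith
      then show "dist (E u) (E v) \<le> (B * L + M * B) * dist u v"
        by (simp add: dist_real_def algebra_simps)
    qed (use B L M in auto)
    moreover
    obtain N1 where N1: "N1 \<in> null_sets lebesgue" "\<And>u. u \<notin> N1 \<Longrightarrow> u \<in> I \<Longrightarrow>
           (\<exists>a. (x' has_real_derivative a) (at u within I) \<and> a \<in> uminus ` D (x u))"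
      using AE_E3[OF ae] by (metis (no_types, lifting) Diff_iff UNIV_I space_completion space_lborel space_borel)
    \<comment> \<open>\<open>U\<close> may fail to be differentiable at the positions in
      \<open>N\<close>. Passages through them with nonzero velocity are discarded as a null set;
      those with zero velocity need only that \<open>U\<close> is Lipschitz.\<close>
    define Z where "Z = {u\<in>I. x u \<in> N \<and> x' u \<noteq> 0}"
    have "countable Z" unfolding Z_def using countable_noncritical_preimage[OF x N] .
    then have "negligible (N1 \<union> Z)"
      using N1(1) by (simp add: negligible_iff_null_sets[symmetric] countable_imp_negligible)
    moreover have "(E has_real_derivative 0) (at u within {s..t})" if u: "u \<in> {s..t} - (N1 \<union> Z)" for u
    proof -
      have uI: "u \<in> I" using u sub by blast
      obtain a where a: "(x' has_real_derivative a) (at u within I)" "a \<in> uminus ` D (x u)"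
        using N1(2)[of u] u uI by blast
      have xu: "(x has_real_derivative x' u) (at u within I)" using x[OF uI] .
      have "(E has_real_derivative 0) (at u within I)"
      proof (cases "x' u = 0")
        case True
        \<comment> \<open>The increment of \<open>x\<close> is of smaller order than
          \<open>v - u\<close>, and \<open>U\<close> enlarges it by a factor of at most
          \<open>M\<close>. The tolerance is divided by \<open>M + 1\<close> because
          \<open>M\<close> may be zero.\<close>
        have "((\<lambda>v. U (x v)) has_derivative (\<lambda>h. 0)) (at u within I)"
        proof -
          have "(x has_derivative (\<lambda>h. 0)) (at u within I)" using xu True
            by (simp add: has_field_derivative_def lambda_zero)
          note lim = this[unfolded has_derivative_within_alt, THEN conjunct2, rule_format]
          show ?thesis unfolding has_derivative_within_alt
          proof (intro conjI allI impI)
            fix e :: real assume "e > 0"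
            then obtain d where d: "d > 0" 
              "\<And>v. v \<in> I \<Longrightarrow> norm (v - u) < d \<Longrightarrow> norm (x v - x u - 0) \<le> e / (M + 1) * norm (v - u)"
              using lim[of "e / (M + 1)"] M by auto
            have "norm (U (x v) - U (x u) - 0) \<le> e * norm (v - u)" if "v \<in> I" "norm (v - u) < d" for v
            proof -
              have "\<bar>U (x v) - U (x u)\<bar> \<le> M * \<bar>x v - x u\<bar>"
                using lipschitz_onD[OF U, of "x v" "x u"] by (auto simp: dist_real_def)
              also have "\<dots> \<le> (M + 1) * \<bar>x v - x u\<bar>" by (simp add: mult_right_mono)
              also have "\<dots> \<le> (M + 1) * (e / (M + 1) * \<bar>v - u\<bar>)"
                using d(2)[OF that] M by (intro mult_left_mono) auto
              also have "\<dots> = e * \<bar>v - u\<bar>" using M by simp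
              finally show ?thesis by simp
            qed
            then show "\<exists>d>0. \<forall>v\<in>I. norm (v - u) < d \<longrightarrow> norm (U (x v) - U (x u) - 0) \<le> e * norm (v - u)"
              using d(1) by blast
          qed auto
        qed
        then have "((\<lambda>v. U (x v)) has_real_derivative 0) (at u within I)"
          by (simp add: has_field_derivative_def lambda_zero)
        then show ?thesis unfolding E_def
          by (auto intro!: derivative_eq_intros a(1) simp: True)
      next
        case False
        then have "x u \<notin> N" using u sub by (auto simp: Z_def)
        then obtain d where d: "D (x u) = {d}" "(U has_real_derivative d) (at (x u))"
          using dU by blast
        have "((\<lambda>v. U (x v)) has_real_derivative (d * x' u)) (at u within I)"
          by (rule DERIV_chain2[OF d(2) xu])
        \<comment> \<open>Here \<open>a = - d\<close>, so the kinetic term \<open>x' u * a\<close>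
          cancels the potential term \<open>d * x' u\<close>.\<close>
        then show ?thesis using a d(1) unfolding E_def
          by (auto intro!: derivative_eq_intros a(1))
      qed
      then show ?thesis using has_field_derivative_subset sub by blast
    qed
    ultimately show ?thesis
      using lipschitz_on_AE_zero_deriv_const[OF \<open>s \<le> t\<close>] by blast
  qed
  then have "E s = E t" if "s \<in> I" "t \<in> I" for s t
    using that by (metis linorder_le_cases)
  then show ?thesis unfolding E_def by (metis)
qed

text \<open>Factor the difference of squares in the energy identity. Near a time with speed
  \<open>w\<close> the two velocities add up to about \<open>2 * w\<close> in absolute value and the
  displacement is about \<open>w\<close> times the elapsed time, so \<open>w\<close> cancels and the
  constant \<open>M\<close> of \<open>U\<close> passes to \<open>y'\<close>. The equation of motion
  then follows by differentiating \<open>y'\<close> as a signed square root.\<close>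

lemma energy_constant_imp_solution:
  fixes y y' U :: "real \<Rightarrow> real" and D :: "real \<Rightarrow> real set"
  assumes U: "M-lipschitz_on UNIV U" and N: "countable N"
    and dU: "\<And>p. p \<notin> N \<Longrightarrow> \<exists>d. D p = {d} \<and> (U has_real_derivative d) (at p)"
    and I: "is_interval I"
    and y: "\<And>t. t \<in> I \<Longrightarrow> (y has_real_derivative y' t) (at t within I)"
    and cont: "continuous_on I y'" and nz: "\<And>t. t \<in> I \<Longrightarrow> y' t \<noteq> 0"
    and E: "\<And>t. t \<in> I \<Longrightarrow> (y' t)\<^sup>2 / 2 + U (y t) = c"
  shows "M-lipschitz_on I y'"
    and "AE t in lebesgue. t \<in> I \<longrightarrow>
           (\<exists>a. (y' has_real_derivative a) (at t within I) \<and> a \<in> uminus ` D (y t))"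
proof -
  have M: "0 \<le> M" using U by (rule lipschitz_on_nonneg)
  have *: "\<bar>y' v - y' u\<bar> \<le> M * (v - u) + e * (v - u)" if st: "u \<in> I" "v \<in> I" "u \<le> v" and "e > 0" for u v e
  proof -
    have sub: "{u..v} \<subseteq> I" using mem_is_interval_1_I[OF I st(1,2)] by auto
    define P where "P a b \<longleftrightarrow> (u \<le> a \<and> b \<le> v \<longrightarrow> \<bar>y' b - y' a\<bar> \<le> M * (b - a) + e * (b - a))" for a b
    have "P u v"
      using \<open>u \<le> v\<close>
    proof (induction u v rule: Bolzano)
      case (trans a b c)
      then show ?case unfolding P_def by (auto simp: algebra_simps)
    next
      case (local z)
      then have z: "z \<in> I" using sub by auto
      define w where "w = \<bar>y' z\<bar>"
      have w: "w > 0" using nz z by (simp add: w_def)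
      \<comment> \<open>Chosen so that \<open>(M + e) * k = e * w\<close>. This yields the
        inequality \<open>le\<close> below, by which the perturbed quotient
        \<open>M * (2 * w + k) / (2 * w - k)\<close> is at most \<open>M + e\<close>.\<close>
      define k where "k = e * w / (M + e)"
      have k: "k > 0" "k \<le> w"
        using w M \<open>e > 0\<close> by (auto simp: k_def field_simps)
      obtain d where d: "d > 0" "\<And>t. t \<in> I \<Longrightarrow> \<bar>t - z\<bar> < d \<Longrightarrow> \<bar>y' t - y' z\<bar> < k / 2"
        using cont z k unfolding continuous_on_iff dist_real_def by (meson half_gt_zero)
      have "P a b" if ab: "a \<le> z" "z \<le> b" "b - a < d" for a b
        unfolding P_def
      proof (intro impI)
        assume uv: "u \<le> a \<and> b \<le> v"
        have abI: "{a..b} \<subseteq> I" using sub uv by auto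
        have near: "\<bar>y' t - y' z\<bar> < k / 2" if "t \<in> {a..b}" for t
          using d(2)[of t] that abI ab by auto
        have A1: "2 * w - k \<le> \<bar>y' a + y' b\<bar>"
        proof -
          have "\<bar>y' a - y' z\<bar> < k / 2" "\<bar>y' b - y' z\<bar> < k / 2" using near[of a] near[of b] ab by auto
          then show ?thesis unfolding w_def by linarith
        qed
        have A2: "\<bar>y b - y a\<bar> \<le> (w + k / 2) * (b - a)"
        proof -
          have "(w + k/2)-lipschitz_on {a..b} y"
          proof (rule bounded_derivative_imp_lipschitz)
            show "(y has_derivative (*) (y' t)) (at t within {a..b})" if "t \<in> {a..b}" for t
              using y[of t] that abI has_field_derivative_subset[of y "y' t" t I "{a..b}"]
              by (auto simp: has_field_derivative_def)
            show "onorm ((*) (y' t)) \<le> w + k/2" if "t \<in> {a..b}" for t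
            proof -
              have "\<bar>y' t\<bar> \<le> w + k/2" using near[OF that] unfolding w_def by linarith
              then show ?thesis by (intro onorm_le) (auto simp: abs_mult mult_right_mono)
            qed
          qed (use w k in auto)
          from lipschitz_onD[OF this, of b a] show ?thesis using ab by (auto simp: dist_real_def)
        qed
        have A3: "\<bar>y' b - y' a\<bar> * \<bar>y' a + y' b\<bar> = 2 * \<bar>U (y b) - U (y a)\<bar>"
        proof -
          have "(y' b - y' a) * (y' a + y' b) = - 2 * (U (y b) - U (y a))"
            using E[of a] E[of b] subsetD[OF abI, of a] subsetD[OF abI, of b] ab by (auto simp: power2_eq_square algebra_simps)
          then have "\<bar>y' b - y' a\<bar> * \<bar>y' a + y' b\<bar> = \<bar>- 2 * (U (y b) - U (y a))\<bar>"
            unfolding abs_mult[symmetric] by (rule arg_cong)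
          also have "\<dots> = 2 * \<bar>U (y b) - U (y a)\<bar>" unfolding abs_mult by simp
          finally show ?thesis .
        qed
        have A4: "\<bar>U (y b) - U (y a)\<bar> \<le> M * \<bar>y b - y a\<bar>"
          using lipschitz_onD[OF U, of "y b" "y a"] by (auto simp: dist_real_def)
        have le: "M * (2 * w + k) \<le> (M + e) * (2 * w - k)"
        proof -
          have "(M + e) * k = e * w" using M \<open>e > 0\<close> by (simp add: k_def)
          moreover have "0 \<le> e * k" using k \<open>e > 0\<close> by simp
          ultimately show ?thesis by (simp add: algebra_simps)
        qed
        have "\<bar>y' b - y' a\<bar> * (2 * w - k) \<le> \<bar>y' b - y' a\<bar> * \<bar>y' a + y' b\<bar>"
          by (rule mult_left_mono[OF A1]) simp
        also have "\<dots> \<le> 2 * (M * \<bar>y b - y a\<bar>)" unfolding A3 using A4 by simp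
        also have "\<dots> \<le> 2 * (M * ((w + k/2) * (b - a)))" using mult_left_mono[OF A2 M] by simp
        also have "\<dots> = (M * (2 * w + k)) * (b - a)" by (simp add: field_simps)
        also have "(M * (2 * w + k)) * (b - a) \<le> (M + e) * (2 * w - k) * (b - a)"
          using ab by (intro mult_right_mono le) auto
        finally have "\<bar>y' b - y' a\<bar> * (2 * w - k) \<le> ((M + e) * (b - a)) * (2 * w - k)"
          by (simp add: mult_ac)
        then have "\<bar>y' b - y' a\<bar> \<le> (M + e) * (b - a)" using k by (simp add: mult_le_cancel_right)
        then show "\<bar>y' b - y' a\<bar> \<le> M * (b - a) + e * (b - a)" by (simp add: algebra_simps)
      qed
      then show ?case using d(1) by blast
    qed
    then show ?thesis by (simp add: P_def)
  qed
  have **: "\<bar>y' v - y' u\<bar> \<le> M * (v - u)" if st: "u \<in> I" "v \<in> I" "u \<le> v" for u v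
  proof (rule field_le_epsilon)
    fix e :: real assume "e > 0"
    \<comment> \<open>Dividing the tolerance by the length plus 1 keeps the accumulated error below
      \<open>e\<close>, also when \<open>u = v\<close>.\<close>
    then have "\<bar>y' v - y' u\<bar> \<le> M * (v - u) + (e / (v - u + 1)) * (v - u)"
      using st by (intro *) auto
    also have "(e / (v - u + 1)) * (v - u) \<le> e" using \<open>e > 0\<close> st by (simp add: field_simps)
    finally show "\<bar>y' v - y' u\<bar> \<le> M * (v - u) + e" by simp
  qed
  show "M-lipschitz_on I y'"
  proof (rule lipschitz_onI)
    fix u v assume "u \<in> I" "v \<in> I"
    then show "dist (y' u) (y' v) \<le> M * dist u v"
      using **[of u v] **[of v u] by (cases "u \<le> v") (auto simp: dist_real_def abs_minus_commute)
  qed (rule M)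
  define Z where "Z = {t\<in>I. y t \<in> N \<and> y' t \<noteq> 0}"
  have "countable Z" unfolding Z_def using countable_noncritical_preimage[OF y N] .
  then have Z: "Z \<in> null_sets lebesgue"
    using countable_imp_negligible negligible_iff_null_sets by blast
  have der: "(y' has_real_derivative - d) (at t within I)"
    if t: "t \<in> I" and d: "(U has_real_derivative d) (at (y t))" for t d
  proof -
    \<comment> \<open>A continuous velocity without zeros on an interval has a constant sign, so the
      energy determines \<open>y'\<close> as \<open>\<sigma>\<close> times a square root of a
      positive quantity.\<close>
    define \<sigma> where "\<sigma> = sgn (y' t)"
    have conn: "connected I" using I by (simp add: is_interval_connected_1)
    have same: "sgn (y' s) = \<sigma>" if "s \<in> I" for s
    proof (rule ccontr)
      assume "\<not> ?thesis"
      then have "(y' s < 0 \<and> 0 < y' t) \<or> (y' t < 0 \<and> 0 < y' s)"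
        using nz[OF that] nz[OF t] by (auto simp: \<sigma>_def sgn_if split: if_splits)
      moreover have "is_interval (y' ` I)"
        using connected_continuous_image[OF cont conn] by (simp add: is_interval_connected_1)
      ultimately have "0 \<in> y' ` I" using that t unfolding is_interval_1 by (meson imageI less_imp_le)
      then show False using nz by auto
    qed
    have eq: "y' s = \<sigma> * sqrt (2 * (c - U (y s)))" if "s \<in> I" for s
    proof -
      have "2 * (c - U (y s)) = (y' s)\<^sup>2" using E[OF that] by simp
      then have "sqrt (2 * (c - U (y s))) = \<bar>y' s\<bar>" by simp
      then show ?thesis using same[OF that] by (metis sgn_mult_abs)
    qed
    have pos: "2 * (c - U (y t)) > 0"
    proof -
      have "2 * (c - U (y t)) = (y' t)\<^sup>2" using E[OF t] by simp
      then show ?thesis using nz[OF t] by simp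
    qed
    have "((\<lambda>s. U (y s)) has_real_derivative (d * y' t)) (at t within I)"
      by (rule DERIV_chain2[OF d y[OF t]])
    then have "((\<lambda>s. \<sigma> * sqrt (2 * (c - U (y s)))) has_real_derivative
        (\<sigma> * ((- 2 * (d * y' t)) * (inverse (sqrt (2 * (c - U (y t)))) / 2)))) (at t within I)"
      using pos by (auto intro!: derivative_eq_intros)
    also have "\<sigma> * ((- 2 * (d * y' t)) * (inverse (sqrt (2 * (c - U (y t)))) / 2)) = - d"
    proof -
      have "\<sigma> * \<sigma> = 1" using nz[OF t] by (simp add: \<sigma>_def sgn_if)
      moreover have "sqrt (2 * (c - U (y t))) \<noteq> 0" using pos by simp
      ultimately show ?thesis
        by (subst eq[OF t]) (simp add: field_simps)
    qed
    finally show ?thesis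
      by (rule has_field_derivative_transform_within[where d = 1]) (use t eq in auto)
  qed
  show "AE t in lebesgue. t \<in> I \<longrightarrow>
           (\<exists>a. (y' has_real_derivative a) (at t within I) \<and> a \<in> uminus ` D (y t))"
  proof (rule AE_I'[OF Z], clarsimp)
    fix t assume t: "t \<in> I" and no: "\<forall>a. (y' has_real_derivative a) (at t within I) \<longrightarrow> a \<notin> uminus ` D (y t)"
    show "t \<in> Z"
    proof (rule ccontr)
      assume "t \<notin> Z"
      then have "y t \<notin> N" using t nz by (auto simp: Z_def)
      then obtain d where "D (y t) = {d}" "(U has_real_derivative d) (at (y t))" using dU by blast
      then show False using der[OF t] no by blast
    qed
  qed
qed

section \<open>Plane geometry\<close>

text \<open>The coordinate map matches boxes with boxes of the same volume, which characterises
  Lebesgue measure. This carries \<open>content_triangle\<close> from \<open>real^2\<close> to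
  pairs.\<close>

lemma lborel_prod_eq_distr_vec:
  "(lborel :: (real \<times> real) measure) = distr lborel borel (\<lambda>x::real^2. (x $ 1, x $ 2))"
proof (rule lborel_eqI)
  fix l u :: "real \<times> real"
  assume lu: "\<And>b. b \<in> Basis \<Longrightarrow> l \<bullet> b \<le> u \<bullet> b"
  have 1: "fst l \<le> fst u" "snd l \<le> snd u"
    using lu[of "(1, 0)"] lu[of "(0, 1)"] by (auto simp: Basis_prod_def inner_prod_def)
  define l' u' :: "real^2" where "l' = vector [fst l, snd l]" and "u' = vector [fst u, snd u]"
  have le: "\<forall>i. l' $ i \<le> u' $ i" using 1 by (simp add: forall_2 l'_def u'_def)
  have vim: "(\<lambda>x::real^2. (x $ 1, x $ 2)) -` box l u = box l' u'"
    unfolding set_eq_iff vimage_eq mem_box_cart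
    by (auto simp: l'_def u'_def forall_2 box_def Basis_prod_def inner_prod_def)
  have meas: "(\<lambda>x::real^2. (x $ 1, x $ 2)) \<in> borel_measurable borel"
    by (intro borel_measurable_continuous_onI continuous_intros)
  have "emeasure (distr lborel borel (\<lambda>x::real^2. (x $ 1, x $ 2))) (box l u) = emeasure lborel (box l' u')"
    using meas by (subst emeasure_distr) (auto simp: vim)
  also have "\<dots> = ennreal (prod ((\<bullet>) (u' - l')) Basis)"
    using le by (intro emeasure_lborel_box) (auto simp: Basis_vec_def inner_axis)
  also have "prod ((\<bullet>) (u' - l')) Basis = (\<Prod>i\<in>UNIV. (u' - l') $ i)"
  proof -
    have B: "(Basis :: (real^2) set) = range (\<lambda>i. axis i 1)" by (auto simp: Basis_vec_def)
    have "inj (\<lambda>i::2. axis i (1::real))" by (auto simp: inj_on_def axis_eq_axis)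
    then show ?thesis unfolding B by (subst prod.reindex) (auto simp: inner_axis)
  qed
  also have "\<dots> = (fst u - fst l) * (snd u - snd l)"
    by (simp add: UNIV_2 l'_def u'_def)
  also have "\<dots> = (\<Prod>b\<in>Basis. (u - l) \<bullet> b)"
  proof -
    have B: "(Basis :: (real \<times> real) set) = {(1, 0), (0, 1)}" by (auto simp: Basis_prod_def)
    show ?thesis unfolding B by (simp add: inner_prod_def)
  qed
  finally show "emeasure (distr lborel borel (\<lambda>x::real^2. (x $ 1, x $ 2))) (box l u)
      = ennreal (\<Prod>b\<in>Basis. (u - l) \<bullet> b)" .
qed simp

lemma measure_triangle:
  fixes u v :: "real \<times> real"
  shows "measure lebesgue (convex hull {0, u, v}) = \<bar>fst u * snd v - snd u * fst v\<bar> / 2"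
proof -
  define \<phi> :: "real^2 \<Rightarrow> real \<times> real" where "\<phi> x = (x $ 1, x $ 2)" for x
  define \<psi> :: "real \<times> real \<Rightarrow> real^2" where "\<psi> p = vector [fst p, snd p]" for p
  have inv: "\<phi> (\<psi> p) = p" "\<psi> (\<phi> x) = x" for p x
    by (auto simp: \<phi>_def \<psi>_def vec_eq_iff forall_2)
  have lin: "linear \<psi>"
    by (rule linearI) (auto simp: \<psi>_def vec_eq_iff forall_2)
  let ?T = "convex hull {0, u, v}"
  have "compact ?T" by (intro finite_imp_compact_convex_hull) auto
  then have "closed ?T" by (rule compact_imp_closed)
  then have T: "?T \<in> sets borel" by (rule borel_closed)
  have meas: "\<phi> \<in> borel_measurable borel" unfolding \<phi>_def
    by (intro borel_measurable_continuous_onI continuous_intros)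
  have "measure lebesgue ?T = measure lborel ?T" using T by (simp add: measure_completion)
  also have "\<dots> = measure (distr lborel borel \<phi>) ?T"
    unfolding \<phi>_def by (subst lborel_prod_eq_distr_vec) simp
  also have "\<dots> = measure lborel (\<phi> -` ?T)" using meas T by (subst measure_distr) auto
  also have "\<phi> -` ?T = \<psi> ` ?T"
  proof (intro set_eqI iffI)
    fix x assume "x \<in> \<phi> -` ?T" then show "x \<in> \<psi> ` ?T" using inv(2)[of x] by (metis imageI vimage_eq)
  next
    fix x assume "x \<in> \<psi> ` ?T" then show "x \<in> \<phi> -` ?T" using inv(1) by auto
  qed
  also have "\<dots> = convex hull {0, \<psi> u, \<psi> v}"
    using convex_hull_linear_image[OF lin, of "{0, u, v}"] linear_0[OF lin] by simp
  finally show ?thesis unfolding content_triangle by (simp add: \<psi>_def mult_ac)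
qed

lemma negligible_line:
  fixes n :: "real \<times> real"
  assumes "n \<noteq> 0" shows "negligible {x. n \<bullet> x = 0}"
  using assms by (intro negligible_hyperplane) auto

section \<open>Directions and polar coordinates\<close>

definition dir :: "real \<Rightarrow> real \<times> real" where "dir a = (cos a, sin a)"

text \<open>The derivative of \<open>dir\<close>, which is \<open>dir\<close> turned by a right
  angle.\<close>

definition dir' :: "real \<Rightarrow> real \<times> real" where "dir' a = (- sin a, cos a)"

lemma norm_dir [simp]: "norm (dir a) = 1"
  by (simp add: dir_def norm_prod_def)

lemma dir_shift: "dir (t + 2 * pi * of_int k) = dir t"
  using cos_int_2pin[of k] sin_int_2pin[of k] by (simp add: dir_def cos_add sin_add)

text \<open>The chord has length \<open>2 * \<bar>sin c\<bar>\<close>, where \<open>c\<close> is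
  half the difference of the angles.\<close>

lemma norm_dir_diff: "norm (dir a - dir b) \<le> \<bar>a - b\<bar>"
proof -
  obtain c where c: "a - b = 2 * c" by (metis field_sum_of_halves mult_2)
  have "(norm (dir a - dir b))\<^sup>2 = (cos a - cos b)\<^sup>2 + (sin a - sin b)\<^sup>2"
    by (simp add: dir_def norm_prod_def)
  also have "\<dots> = ((cos a)\<^sup>2 + (sin a)\<^sup>2) + ((cos b)\<^sup>2 + (sin b)\<^sup>2) - 2 * (cos a * cos b + sin a * sin b)"
    by (simp add: power2_eq_square algebra_simps)
  also have "\<dots> = 2 - 2 * cos (2 * c)" unfolding c[symmetric] by (simp add: cos_diff)
  also have "\<dots> = (2 * sin c)\<^sup>2"
    by (subst cos_double_sin) (simp add: power2_eq_square)
  also have "\<dots> \<le> (2 * c)\<^sup>2"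
    using abs_sin_x_le_abs_x[of c] by (subst abs_le_square_iff[symmetric]) (simp add: abs_mult)
  finally have "(norm (dir a - dir b))\<^sup>2 \<le> \<bar>a - b\<bar>\<^sup>2" by (simp only: c power2_abs)
  then show ?thesis by (rule power2_le_imp_le) simp
qed

lemma polar_form: obtains t where "0 \<le> t" "t < 2 * pi" "v = norm v *\<^sub>R dir t"
proof (cases "v = 0")
  case True
  then show ?thesis using that[of 0] by simp
next
  case False
  have "(fst v / norm v)\<^sup>2 + (snd v / norm v)\<^sup>2 = ((fst v)\<^sup>2 + (snd v)\<^sup>2) / (norm v)\<^sup>2"
    by (simp add: power_divide add_divide_distrib)
  also have "\<dots> = 1" using False
    by (simp add: power2_norm_eq_inner inner_prod_def power2_eq_square[of "fst v"] power2_eq_square[of "snd v"])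
      (simp add: prod_eq_iff)
  finally obtain t where "0 \<le> t" "t < 2*pi" "fst v / norm v = cos t" "snd v / norm v = sin t"
    using sincos_total_2pi by metis
  then have "fst v = norm v * cos t" "snd v = norm v * sin t"
    using False by (simp_all add: field_simps)
  then have "v = norm v *\<^sub>R dir t" by (simp add: dir_def prod_eq_iff)
  then show ?thesis using that \<open>0 \<le> t\<close> \<open>t < 2 * pi\<close> by blast
qed

lemma polar_form_shifted:
  obtains t where "a \<le> t" "t < a + 2 * pi" "v = norm v *\<^sub>R dir t"
proof -
  obtain t where t: "v = norm v *\<^sub>R dir t" using polar_form by blast
  define k where "k = \<lfloor>(t - a) / (2 * pi)\<rfloor>"
  have "of_int k \<le> (t - a) / (2 * pi)" "(t - a) / (2 * pi) < of_int k + 1"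
    unfolding k_def by linarith+
  then have "2 * pi * of_int k \<le> t - a" "t - a < 2 * pi * of_int k + 2 * pi"
    by (simp_all add: field_simps)
  moreover have "dir (t + 2 * pi * of_int (- k)) = dir t" by (rule dir_shift)
  ultimately show ?thesis using that[of "t + 2 * pi * of_int (- k)"] t by auto
qed

text \<open>Cramer's rule: the cross product of two unit vectors is the sine of the angle between
  them.\<close>

lemma dir_decomp:
  assumes "sin (b - a) \<noteq> 0"
  shows "dir s = (sin (b - s) / sin (b - a)) *\<^sub>R dir a + (sin (s - a) / sin (b - a)) *\<^sub>R dir b"
proof -
  have "cos s * sin (b - a) = sin (b - s) * cos a + sin (s - a) * cos b"
       "sin s * sin (b - a) = sin (b - s) * sin a + sin (s - a) * sin b"
    by (simp_all add: sin_diff algebra_simps)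
  then show ?thesis using assms by (simp add: dir_def field_simps)
qed

text \<open>The angle is first taken in the full turn that starts at \<open>a\<close>. The cross
  products of the vector with \<open>dir a\<close> and \<open>dir b\<close> have known signs, and
  these confine the angle to \<open>[a, b]\<close>.\<close>

lemma cone_comb_polar:
  assumes ab: "0 < b - a" "b - a < pi" and nn: "0 \<le> \<alpha>" "0 \<le> \<beta>"
  shows "\<exists>r s. 0 \<le> r \<and> a \<le> s \<and> s \<le> b \<and> \<alpha> *\<^sub>R dir a + \<beta> *\<^sub>R dir b = r *\<^sub>R dir s"
proof -
  define v where "v = \<alpha> *\<^sub>R dir a + \<beta> *\<^sub>R dir b"
  obtain s where s: "a \<le> s" "s < a + 2 * pi" "v = norm v *\<^sub>R dir s" using polar_form_shifted .
  show ?thesis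
  proof (cases "v = 0")
    case True
    then show ?thesis using ab unfolding v_def by (intro exI[of _ 0] exI[of _ a]) auto
  next
    case False
    have sp: "sin (b - a) > 0" using ab by (intro sin_gt_zero) auto
    have c: "fst v = norm v * cos s" "snd v = norm v * sin s"
      using s(3) by (auto simp: dir_def dest: arg_cong[where f = fst] arg_cong[where f = snd]) 
    have "norm v * sin (s - a) = cos a * snd v - sin a * fst v" 
      unfolding c sin_diff by (simp add: algebra_simps)
    also have "\<dots> = \<beta> * sin (b - a)"
      unfolding v_def by (simp add: dir_def sin_diff algebra_simps)
    finally have 1: "norm v * sin (s - a) = \<beta> * sin (b - a)" .
    have "norm v * sin (b - s) = sin b * fst v - cos b * snd v"
      unfolding c sin_diff by (simp add: algebra_simps)
    also have "\<dots> = \<alpha> * sin (b - a)"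
      unfolding v_def by (simp add: dir_def sin_diff algebra_simps)
    finally have 2: "norm v * sin (b - s) = \<alpha> * sin (b - a)" .
    have "0 \<le> norm v * sin (s - a)" "0 \<le> norm v * sin (b - s)" using 1 2 nn sp by auto
    then have 3: "0 \<le> sin (s - a)" "0 \<le> sin (b - s)"
      using False by (auto simp: zero_le_mult_iff)
    have "s - a \<le> pi"
    proof (rule ccontr)
      assume "\<not> ?thesis"
      then have "sin (s - a) < 0" using s by (intro sin_lt_zero) auto
      then show False using 3 by simp
    qed
    moreover have "s \<le> b"
    proof (rule ccontr)
      assume "\<not> s \<le> b"
      then have "0 < sin (s - b)" using ab \<open>s - a \<le> pi\<close> by (intro sin_gt_zero) auto
      then show False using 3 sin_minus[of "s - b"] by simp
    qed
    ultimately show ?thesis using s v_def by (metis norm_ge_zero)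
  qed
qed

lemma dir_eq_iff_shift:
  assumes "dir s = dir t" "s \<le> t" "t \<le> s + 2 * pi"
  shows "t = s \<or> t = s + 2 * pi"
proof -
  have "cos (t - s) = 1" using assms(1)
    by (simp add: dir_def cos_diff)
  then obtain n :: int where n: "t - s = of_int n * 2 * pi" by (auto simp: cos_one_2pi_int)
  have pos: "0 < 2 * pi" by simp
  have "0 * (2 * pi) \<le> of_int n * (2 * pi)" "of_int n * (2 * pi) \<le> 1 * (2 * pi)"
    using n assms(2,3) by linarith+
  then have "(0::real) \<le> of_int n" "of_int n \<le> (1::real)"
    using mult_le_cancel_right_pos[OF pos] by blast+
  then have "n = 0 \<or> n = 1" by linarith
  then show ?thesis using n by auto
qed

section \<open>Generalised trigonometric functions of a polar body\<close>

text \<open>The radii are parameters because \<open>polar D\<close> satisfies the same assumptions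
  with radii \<open>1 / R\<close> and \<open>1 / r\<close>; the locale can thus be used for a body
  and for its polar at once.\<close>

locale body_around_0 =
  fixes D :: "(real \<times> real) set" and r R :: real
  assumes compact_D: "compact D" and r_pos: "0 < r"
    and inner: "cball 0 r \<subseteq> D" and outer: "D \<subseteq> cball 0 R"
begin

section \<open>Support function\<close>

definition supp :: "real \<times> real \<Rightarrow> real" where
  "supp v = (SUP P\<in>D. P \<bullet> v)"

definition eta :: "real \<Rightarrow> real" where "eta a = supp (dir a)"

lemma D_ne: "D \<noteq> {}" using inner r_pos by auto

lemma norm_D: "P \<in> D \<Longrightarrow> norm P \<le> R" using outer by auto

lemma R_pos: "0 < R"
proof -
  have "norm (r *\<^sub>R dir 0) \<le> R" using inner r_pos by (intro norm_D subsetD[OF inner]) auto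
  then show ?thesis using r_pos by simp
qed

lemma supp_attained: obtains P where "P \<in> D" "P \<bullet> v = supp v" "\<And>Q. Q \<in> D \<Longrightarrow> Q \<bullet> v \<le> supp v"
proof -
  have "continuous_on D (\<lambda>P. P \<bullet> v)" by (intro continuous_intros)
  then obtain P where P: "P \<in> D" "\<And>Q. Q \<in> D \<Longrightarrow> Q \<bullet> v \<le> P \<bullet> v"
    using continuous_attains_sup[OF compact_D D_ne] by blast
  then have "supp v = P \<bullet> v" unfolding supp_def
    by (intro cSup_eq_maximum) auto
  then show ?thesis using P that by auto
qed

lemma supp_ge: "P \<in> D \<Longrightarrow> P \<bullet> v \<le> supp v"
  using supp_attained by blast

lemma supp_le_iff: "supp v \<le> c \<longleftrightarrow> (\<forall>P\<in>D. P \<bullet> v \<le> c)"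
  using supp_attained[of v] supp_ge by (metis order_trans)

text \<open>A maximiser for \<open>v\<close> competes in the supremum for \<open>w\<close>, and its
  norm is at most \<open>R\<close>.\<close>

lemma supp_lipschitz: "\<bar>supp v - supp w\<bar> \<le> R * norm (v - w)"
proof -
  have "supp v - supp w \<le> R * norm (v - w)" for v w
  proof -
    obtain P where P: "P \<in> D" "P \<bullet> v = supp v" using supp_attained by blast
    have "supp v - supp w \<le> P \<bullet> v - P \<bullet> w" using supp_ge[OF P(1)] P(2) by simp
    also have "\<dots> = P \<bullet> (v - w)" by (simp add: inner_diff_right)
    also have "\<dots> \<le> norm P * norm (v - w)" by (rule norm_cauchy_schwarz)
    also have "\<dots> \<le> R * norm (v - w)" using norm_D[OF P(1)] by (intro mult_right_mono) auto
    finally show ?thesis .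
  qed
  from this[of v w] this[of w v] show ?thesis by (simp add: norm_minus_commute)
qed

lemma supp_scale: "0 \<le> t \<Longrightarrow> supp (t *\<^sub>R v) = t * supp v"
proof -
  assume t: "0 \<le> t"
  obtain P where P: "P \<in> D" "P \<bullet> v = supp v" using supp_attained by blast
  have "t * supp v \<le> supp (t *\<^sub>R v)" using supp_ge[OF P(1), of "t *\<^sub>R v"] P(2) by simp
  moreover have "supp (t *\<^sub>R v) \<le> t * supp v"
    unfolding supp_le_iff using supp_ge t by (simp add: mult_left_mono)
  ultimately show ?thesis by simp
qed

lemma supp_lower: "r * norm v \<le> supp v"
proof (cases "v = 0")
  case True
  then show ?thesis using supp_scale[of 0 0] by simp
next
  case False
  have "(r / norm v) *\<^sub>R v \<in> D" using r_pos False by (intro subsetD[OF inner]) auto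
  then have "((r / norm v) *\<^sub>R v) \<bullet> v \<le> supp v" by (rule supp_ge)
  then show ?thesis using False by (simp add: dot_square_norm power2_eq_square)
qed

lemma eta_lower: "r \<le> eta a" using supp_lower[of "dir a"] by (simp add: eta_def)

lemma eta_pos: "0 < eta a" using eta_lower[of a] r_pos by linarith

lemma eta_upper: "eta a \<le> R"
  using supp_lipschitz[of "dir a" 0] supp_scale[of 0 0] by (simp add: eta_def)

lemma eta_lipschitz: "\<bar>eta a - eta b\<bar> \<le> R * \<bar>a - b\<bar>"
  using supp_lipschitz[of "dir a" "dir b"] mult_left_mono[OF norm_dir_diff[of a b], of R] R_pos
  unfolding eta_def by linarith

lemma continuous_eta: "continuous_on S eta"
proof -
  have "R-lipschitz_on S eta"
    by (rule lipschitz_onI) (use eta_lipschitz R_pos in \<open>auto simp: dist_real_def\<close>)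
  then show ?thesis by (rule lipschitz_on_continuous_on)
qed

lemma eta_shift: "eta (a + 2 * pi * of_int k) = eta a"
  by (simp add: eta_def dir_shift)

section \<open>Polar body and bipolar theorem\<close>

lemma polar_iff: "v \<in> polar D \<longleftrightarrow> (\<forall>P\<in>D. P \<bullet> v \<le> 1)"
  by (simp add: polar_def inner_prod_def case_prod_unfold mult.commute)

text \<open>Thus \<open>supp\<close> is the gauge of the polar body, whence the radial function of
  the polar is the reciprocal of \<open>eta\<close>.\<close>

lemma polar_eq: "polar D = {v. supp v \<le> 1}"
  by (simp add: set_eq_iff polar_iff supp_le_iff)

lemma ray_in_polar: "0 \<le> t \<Longrightarrow> t *\<^sub>R dir a \<in> polar D \<longleftrightarrow> t \<le> 1 / eta a"
  using eta_pos[of a] by (simp add: polar_eq supp_scale eta_def field_simps)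

lemma radial_polar: "radial (polar D) a = 1 / eta a"
proof -
  have "{t. 0 \<le> t \<and> t *\<^sub>R (cos a, sin a) \<in> polar D} = {0..1 / eta a}"
    using ray_in_polar[of _ a] unfolding dir_def by auto
  then show ?thesis using eta_pos[of a] by (simp add: radial_def)
qed

lemma polar_outer: "polar D \<subseteq> cball 0 (1 / r)"
proof
  fix v assume "v \<in> polar D"
  then have "r * norm v \<le> 1" using supp_lower[of v] by (simp add: polar_eq)
  then show "v \<in> cball 0 (1 / r)" using r_pos by (simp add: field_simps)
qed

lemma polar_inner: "cball 0 (1 / R) \<subseteq> polar D"
proof
  fix v :: "real \<times> real" assume "v \<in> cball 0 (1 / R)"
  then have "R * norm v \<le> 1" using R_pos by (simp add: field_simps)
  then show "v \<in> polar D" using supp_lipschitz[of v 0] supp_scale[of 0 0] by (simp add: polar_eq)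
qed

lemma convex_polar: "convex (polar D)" and closed_polar: "closed (polar D)"
proof -
  have eq: "polar D = (\<Inter>P\<in>D. {v. P \<bullet> v \<le> 1})"
    by (intro set_eqI) (simp only: polar_iff INT_iff mem_Collect_eq)
  show "convex (polar D)" unfolding eq by (intro convex_INT convex_halfspace_le)
  show "closed (polar D)" unfolding eq by (intro closed_INT ballI closed_halfspace_le)
qed

lemma compact_polar: "compact (polar D)"
  using closed_polar polar_outer bounded_subset[OF bounded_cball] compact_eq_bounded_closed by blast

lemma body_around_0_polar: "body_around_0 (polar D) (1 / R) (1 / r)"
  using compact_polar polar_inner polar_outer R_pos by unfold_locales auto

text \<open>The bipolar theorem: a point outside \<open>D\<close> is cut off by a hyperplane, and
  the rescaled normal lies in \<open>polar D\<close> and excludes the point from the second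
  polar.\<close>

lemma polar_polar:
  assumes "convex D"
  shows "polar (polar D) = D"
proof -
  interpret P: body_around_0 "polar D" "1 / R" "1 / r" by (rule body_around_0_polar)
  show ?thesis
  proof (intro set_eqI iffI)
    fix z assume "z \<in> D"
    then show "z \<in> polar (polar D)" unfolding P.polar_iff using polar_iff by (metis inner_commute)
  next
    fix z assume z: "z \<in> polar (polar D)"
    show "z \<in> D"
    proof (rule ccontr)
      assume "z \<notin> D"
      then obtain a b where ab: "a \<bullet> z < b" "\<And>x. x \<in> D \<Longrightarrow> a \<bullet> x > b"
        using separating_hyperplane_closed_point[OF assms compact_imp_closed[OF compact_D]] by blast
      have "0 \<in> D" using inner r_pos by auto
      then have b: "b < 0" using ab(2)[of 0] by simp
      \<comment> \<open>Since \<open>b\<close> is negative, dividing by it turns the lower bound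
        \<open>b\<close> on \<open>D\<close> into the upper bound 1, and turns the strict inequality
        at \<open>z\<close> into a value above 1.\<close>
      have "(1 / b) *\<^sub>R a \<in> polar D"
        unfolding polar_iff using ab(2) b by (auto simp: inner_commute divide_simps dest: less_imp_le)
      then have "((1 / b) *\<^sub>R a) \<bullet> z \<le> 1" using z P.polar_iff by blast
      then show False using ab(1) b by (simp add: divide_simps split: if_splits)
    qed
  qed
qed

section \<open>Area of wedges of the polar body\<close>

text \<open>Frees \<open>sector\<close> from its fixed initial ray, so that an increment of the
  sector area is again the area of a wedge.\<close>

definition wedge :: "real \<Rightarrow> real \<Rightarrow> (real \<times> real) set" where
  "wedge a b = polar D \<inter> {t *\<^sub>R dir s | t s. 0 \<le> t \<and> a \<le> s \<and> s \<le> b}"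

lemma sector_eq: "sector (polar D) b = wedge 0 b"
  by (simp add: sector_def wedge_def dir_def)

lemma compact_wedge: "compact (wedge a b)"
proof -
  have "wedge a b = polar D \<inter> (\<lambda>(t, s). t *\<^sub>R dir s) ` ({0..1 / r} \<times> {a..b})" (is "_ = ?W")
  proof
    show "wedge a b \<subseteq> ?W"
    proof
      fix v assume "v \<in> wedge a b"
      then obtain t s where v: "v \<in> polar D" "v = t *\<^sub>R dir s" "0 \<le> t" "a \<le> s" "s \<le> b"
        by (auto simp: wedge_def)
      then have "t \<le> 1 / r" using polar_outer by force
      then show "v \<in> ?W" using v by force
    qed
    show "?W \<subseteq> wedge a b" unfolding wedge_def by fastforce
  qed
  moreover have "continuous_on ({0..1 / r} \<times> {a..b}) (\<lambda>(t, s). t *\<^sub>R dir s)"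
    unfolding dir_def case_prod_unfold by (intro continuous_intros)
  ultimately show ?thesis
    by (simp add: compact_Int compact_polar compact_continuous_image compact_Times)
qed

lemma lmeasurable_wedge: "wedge a b \<in> lmeasurable"
  using compact_wedge by (rule lmeasurable_compact)

lemma negligible_ray: "negligible {t *\<^sub>R dir a | t. 0 \<le> t}"
proof (rule negligible_subset[OF negligible_line])
  show "dir' a \<noteq> 0" by (auto simp: dir'_def zero_prod_def dest: sin_zero_abs_cos_one)
  show "{t *\<^sub>R dir a | t. 0 \<le> t} \<subseteq> {x. dir' a \<bullet> x = 0}"
    by (auto simp: dir'_def dir_def inner_prod_def algebra_simps)
qed

abbreviation warea :: "real \<Rightarrow> real \<Rightarrow> real" where "warea a b \<equiv> measure lebesgue (wedge a b)"

lemma warea_refl: "warea a a = 0"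
proof -
  have "wedge a a \<subseteq> {t *\<^sub>R dir a | t. 0 \<le> t}" by (auto simp: wedge_def)
  then show ?thesis by (intro negligible_imp_measure0 negligible_subset[OF negligible_ray])
qed

text \<open>The two wedges share only boundary rays: the one at \<open>b\<close>, and after a full
  turn also the one at \<open>a\<close>. Both are null sets.\<close>

lemma warea_add:
  assumes "a \<le> b" "b \<le> c" "c \<le> a + 2 * pi"
  shows "warea a c = warea a b + warea b c"
proof -
  have un: "wedge a c = wedge a b \<union> wedge b c"
    using assms(1,2) unfolding wedge_def by (auto; metis linorder_le_cases order_trans)
  have "wedge a b \<inter> wedge b c \<subseteq> {t *\<^sub>R dir a | t. 0 \<le> t} \<union> {t *\<^sub>R dir b | t. 0 \<le> t}"
  proof
    fix v assume "v \<in> wedge a b \<inter> wedge b c"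
    then obtain t s t' s' where v: "v = t *\<^sub>R dir s" "0 \<le> t" "a \<le> s" "s \<le> b"
       "v = t' *\<^sub>R dir s'" "0 \<le> t'" "b \<le> s'" "s' \<le> c"
      unfolding wedge_def by blast
    have "norm v = t" "norm v = t'" using arg_cong[OF v(1), of norm] arg_cong[OF v(5), of norm] v(2,6) by auto
    then have "t = t'" by linarith
    show "v \<in> {t *\<^sub>R dir a | t. 0 \<le> t} \<union> {t *\<^sub>R dir b | t. 0 \<le> t}"
    proof (cases "t = 0")
      case True
      then show ?thesis using v by auto
    next
      case False
      then have "dir s = dir s'" using v(1,5) \<open>t = t'\<close> by simp
      then have "s' = s \<or> s' = s + 2 * pi"
        using v assms by (intro dir_eq_iff_shift) auto
      then have "s = b \<or> s = a" using v assms by auto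
      then show ?thesis using v by auto
    qed
  qed
  then have "negligible (wedge a b \<inter> wedge b c)"
    by (rule negligible_subset[rotated]) (intro negligible_Un negligible_ray)
  then show ?thesis unfolding un
    using measure_Un3[OF lmeasurable_wedge lmeasurable_wedge] by (simp add: negligible_imp_measure0)
qed

lemma warea_full: "warea 0 (2 * pi) = area (polar D)"
proof -
  have "wedge 0 (2 * pi) = polar D"
    unfolding wedge_def by (auto, metis polar_form norm_ge_zero less_imp_le)
  then show ?thesis by (simp add: area_def)
qed

lemma triangle_area_dir:
  assumes "0 \<le> x" "0 \<le> y" "0 < b - a" "b - a < pi"
  shows "measure lebesgue (convex hull {0, x *\<^sub>R dir a, y *\<^sub>R dir b}) = x * y * sin (b - a) / 2"
proof -
  have "fst (x *\<^sub>R dir a) * snd (y *\<^sub>R dir b) - snd (x *\<^sub>R dir a) * fst (y *\<^sub>R dir b) = x * y * sin (b - a)"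
    by (simp add: dir_def sin_diff algebra_simps)
  moreover have "sin (b - a) > 0" using assms by (intro sin_gt_zero) auto
  ultimately show ?thesis using assms unfolding measure_triangle by (simp add: abs_mult)
qed

lemma lmeasurable_triangle: "convex hull {0, u, v :: real \<times> real} \<in> lmeasurable"
  by (intro lmeasurable_compact finite_imp_compact_convex_hull) auto

text \<open>By convexity the wedge contains the triangle spanned by the origin and its two boundary
  points.\<close>

lemma warea_lower:
  assumes ab: "0 < b - a" "b - a < pi"
  shows "sin (b - a) / (2 * eta a * eta b) \<le> warea a b"
proof -
  have p: "0 \<le> 1 / eta a" "0 \<le> 1 / eta b" using eta_pos[of a] eta_pos[of b] by auto
  have "convex hull {0, (1 / eta a) *\<^sub>R dir a, (1 / eta b) *\<^sub>R dir b} \<subseteq> wedge a b"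
  proof
    fix v assume v: "v \<in> convex hull {0, (1 / eta a) *\<^sub>R dir a, (1 / eta b) *\<^sub>R dir b}"
    have "{0, (1 / eta a) *\<^sub>R dir a, (1 / eta b) *\<^sub>R dir b} \<subseteq> polar D"
      using ray_in_polar[OF p(1), of a] ray_in_polar[OF p(2), of b] ray_in_polar[of 0 a] p by auto
    then have "v \<in> polar D" using v hull_minimal[of _ "polar D" convex] convex_polar by blast
    moreover obtain x y where xy: "0 \<le> x" "0 \<le> y" 
      "v = 0 + x *\<^sub>R ((1 / eta a) *\<^sub>R dir a - 0) + y *\<^sub>R ((1 / eta b) *\<^sub>R dir b - 0)"
      using v unfolding convex_hull_3_alt by blast
    have "\<exists>t s. 0 \<le> t \<and> a \<le> s \<and> s \<le> b \<and> (x * (1 / eta a)) *\<^sub>R dir a + (y * (1 / eta b)) *\<^sub>R dir b = t *\<^sub>R dir s"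
      using ab xy p by (intro cone_comb_polar) auto
    then have "\<exists>t s. 0 \<le> t \<and> a \<le> s \<and> s \<le> b \<and> v = t *\<^sub>R dir s"
      using xy(3) by simp
    ultimately show "v \<in> wedge a b" unfolding wedge_def by blast
  qed
  then have "measure lebesgue (convex hull {0, (1 / eta a) *\<^sub>R dir a, (1 / eta b) *\<^sub>R dir b}) \<le> warea a b"
    by (intro measure_mono_fmeasurable fmeasurableD lmeasurable_triangle lmeasurable_wedge)
  then show ?thesis unfolding triangle_area_dir[OF p ab] by (simp add: field_simps)
qed

text \<open>Every point \<open>P\<close> of \<open>D\<close> gives a constraint
  \<open>P \<bullet> v \<le> 1\<close> on the polar body. Together with the two rays it bounds a
  triangle that contains the wedge.\<close>

lemma warea_upper:
  assumes ab: "0 < b - a" "b - a < pi" and P: "P \<in> D" "0 < P \<bullet> dir a" "0 < P \<bullet> dir b"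
  shows "warea a b \<le> sin (b - a) / (2 * (P \<bullet> dir a) * (P \<bullet> dir b))"
proof -
  define x y where "x = P \<bullet> dir a" and "y = P \<bullet> dir b"
  have p: "0 < x" "0 < y" using P by (auto simp: x_def y_def)
  have sp: "0 < sin (b - a)" using ab by (intro sin_gt_zero) auto
  have "wedge a b \<subseteq> convex hull {0, (1 / x) *\<^sub>R dir a, (1 / y) *\<^sub>R dir b}"
  proof
    fix v assume "v \<in> wedge a b"
    then obtain t s where v: "v \<in> polar D" "v = t *\<^sub>R dir s" "0 \<le> t" "a \<le> s" "s \<le> b"
      by (auto simp: wedge_def)
    define \<alpha> \<beta> where "\<alpha> = t * (sin (b - s) / sin (b - a))" and "\<beta> = t * (sin (s - a) / sin (b - a))"
    have "0 \<le> sin (b - s)" "0 \<le> sin (s - a)" using v ab by (auto intro!: sin_ge_zero)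
    then have nn: "0 \<le> \<alpha>" "0 \<le> \<beta>" using v sp by (auto simp: \<alpha>_def \<beta>_def)
    have veq: "v = \<alpha> *\<^sub>R dir a + \<beta> *\<^sub>R dir b"
      unfolding v(2) \<alpha>_def \<beta>_def using sp by (subst dir_decomp[of b a s]) (auto simp: scaleR_add_right)
    have "P \<bullet> v \<le> 1" using v(1) P(1) polar_iff by blast
    then have "\<alpha> * x + \<beta> * y \<le> 1" unfolding veq by (simp add: x_def y_def inner_add_right)
    moreover have "v = 0 + (\<alpha> * x) *\<^sub>R ((1 / x) *\<^sub>R dir a - 0) + (\<beta> * y) *\<^sub>R ((1 / y) *\<^sub>R dir b - 0)"
      using p by (simp add: veq)
    moreover have "0 \<le> \<alpha> * x" "0 \<le> \<beta> * y" using nn p by auto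
    ultimately show "v \<in> convex hull {0, (1 / x) *\<^sub>R dir a, (1 / y) *\<^sub>R dir b}"
      unfolding convex_hull_3_alt by blast
  qed
  then have "warea a b \<le> measure lebesgue (convex hull {0, (1 / x) *\<^sub>R dir a, (1 / y) *\<^sub>R dir b})"
    by (intro measure_mono_fmeasurable fmeasurableD lmeasurable_triangle lmeasurable_wedge)
  also have "\<dots> = (1 / x) * (1 / y) * sin (b - a) / 2"
    using p ab by (intro triangle_area_dir) auto
  finally show ?thesis by (simp add: x_def y_def field_simps)
qed

text \<open>The point \<open>P\<close> that maximises in direction \<open>a\<close> is kept fixed
  while \<open>b\<close> tends to \<open>a\<close> from either side. The inner and the outer
  triangle then have the same first-order area, since \<open>P \<bullet> dir b\<close> and
  \<open>eta b\<close> both tend to \<open>eta a\<close>.\<close>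

lemma warea_deriv:
  assumes a: "a \<in> {0..2 * pi}"
  shows "(warea 0 has_real_derivative 1 / (2 * (eta a)\<^sup>2)) (at a within {0..2 * pi})"
proof -
  obtain P where P: "P \<in> D" "P \<bullet> dir a = eta a" unfolding eta_def using supp_attained by blast
  define sc where "sc b = sin (b - a) / (b - a)" for b
  have sc: "(sc \<longlongrightarrow> 1) (at a within {0..2 * pi})"
  proof -
    have "((\<lambda>b. sin (b - a)) has_real_derivative 1) (at a within {0..2 * pi})"
      by (auto intro!: derivative_eq_intros)
    then show ?thesis by (simp add: has_field_derivative_iff sc_def[abs_def])
  qed
  have le: "(eta \<longlongrightarrow> eta a) (at a within {0..2 * pi})"
    using continuous_eta[of "{0..2 * pi}"] a by (auto simp: continuous_on)
  have lP: "((\<lambda>b. P \<bullet> dir b) \<longlongrightarrow> eta a) (at a within {0..2 * pi})"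
    unfolding P(2)[symmetric] unfolding dir_def by (intro tendsto_intros)
  have ep: "eta a \<noteq> 0" using eta_pos[of a] by simp
  have "((\<lambda>b. (warea 0 b - warea 0 a) / (b - a)) \<longlongrightarrow> 1 / (2 * (eta a)\<^sup>2)) (at a within {0..2 * pi})"
  proof (rule tendsto_sandwich)
    show "((\<lambda>b. sc b / (2 * eta a * eta b)) \<longlongrightarrow> 1 / (2 * (eta a)\<^sup>2)) (at a within {0..2 * pi})"
      using tendsto_divide[OF sc tendsto_mult[OF tendsto_const[of "2 * eta a"] le]] ep
      by (simp add: power2_eq_square mult.assoc)
    show "((\<lambda>b. sc b / (2 * eta a * (P \<bullet> dir b))) \<longlongrightarrow> 1 / (2 * (eta a)\<^sup>2)) (at a within {0..2 * pi})"
      using tendsto_divide[OF sc tendsto_mult[OF tendsto_const[of "2 * eta a"] lP]] ep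
      by (simp add: power2_eq_square mult.assoc)
    have "eventually (\<lambda>b. 0 < P \<bullet> dir b) (at a within {0..2 * pi})"
      using lP eta_pos by (rule order_tendstoD)
    moreover have "eventually (\<lambda>b. b \<in> {0..2*pi} \<and> b \<noteq> a \<and> \<bar>b - a\<bar> < pi) (at a within {0..2 * pi})"
      by (auto simp: eventually_at dist_real_def intro!: exI[of _ pi])
    ultimately have ev: "eventually (\<lambda>b. sc b / (2 * eta a * eta b) \<le> (warea 0 b - warea 0 a) / (b - a) \<and>
        (warea 0 b - warea 0 a) / (b - a) \<le> sc b / (2 * eta a * (P \<bullet> dir b))) (at a within {0..2 * pi})"
    proof eventually_elim
      case (elim b)
      show ?case
      proof (cases "a < b")
        case True
        then have "warea 0 b - warea 0 a = warea a b" using warea_add[of 0 a b] a elim by auto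
        moreover have "sin (b - a) / (2 * eta a * eta b) \<le> warea a b"
          using True elim by (intro warea_lower) auto
        moreover have "warea a b \<le> sin (b - a) / (2 * eta a * (P \<bullet> dir b))"
          using warea_upper[of b a P] True elim P eta_pos[of a] by auto
        ultimately show ?thesis using True
            divide_right_mono[of "sin (b - a) / (2 * eta a * eta b)" "warea a b" "b - a"]
            divide_right_mono[of "warea a b" "sin (b - a) / (2 * eta a * (P \<bullet> dir b))" "b - a"]
          by (simp add: sc_def mult_ac)
      next
        case False
        then have ba: "b < a" using elim by auto
        then have eq: "(warea 0 b - warea 0 a) / (b - a) = warea b a / (a - b)"
        proof -
          have "warea 0 b - warea 0 a = - warea b a" using warea_add[of 0 b a] a elim ba by auto
          then show ?thesis by (metis minus_diff_eq minus_divide_divide minus_minus)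
        qed
        have sc': "sc b = sin (a - b) / (a - b)"
          unfolding sc_def by (metis minus_diff_eq minus_divide_divide sin_minus)
        have "sin (a - b) / (2 * eta b * eta a) \<le> warea b a"
          using ba elim by (intro warea_lower) auto
        moreover have "warea b a \<le> sin (a - b) / (2 * (P \<bullet> dir b) * eta a)"
          using warea_upper[of a b P] ba elim P eta_pos[of a] by auto
        ultimately show ?thesis using ba
            divide_right_mono[of "sin (a - b) / (2 * eta b * eta a)" "warea b a" "a - b"]
            divide_right_mono[of "warea b a" "sin (a - b) / (2 * (P \<bullet> dir b) * eta a)" "a - b"]
          unfolding eq sc' by (simp add: mult_ac)
      qed
    qed
    show "eventually (\<lambda>b. sc b / (2 * eta a * eta b) \<le> (warea 0 b - warea 0 a) / (b - a)) (at a within {0..2 * pi})"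
      using ev by (rule eventually_mono) simp
    show "eventually (\<lambda>b. (warea 0 b - warea 0 a) / (b - a) \<le> sc b / (2 * eta a * (P \<bullet> dir b))) (at a within {0..2 * pi})"
      using ev by (rule eventually_mono) simp
  qed
  then show ?thesis by (simp add: has_field_derivative_iff)
qed

section \<open>Swept area as a function of the angle\<close>

text \<open>Unlike \<open>warea\<close>, this is defined and increasing on the whole line.\<close>
definition swept :: "real \<Rightarrow> real" where
  "swept u = (LBINT y=ereal 0..ereal u. 1 / (eta y)\<^sup>2)"

lemma swept_0 [simp]: "swept 0 = 0" by (simp add: swept_def)

lemma swept_deriv: "(swept has_real_derivative 1 / (eta a)\<^sup>2) (at a)"
proof -
  \<comment> \<open>The window \<open>{-c..c}\<close> contains the base point 0 of the integral and
    has \<open>a\<close> in its interior, which gives the two-sided derivative.\<close>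
  define c where "c = \<bar>a\<bar> + 1"
  have "continuous_on {-c..c} (\<lambda>y. 1 / (eta y)\<^sup>2)"
    using eta_pos by (intro continuous_intros continuous_eta) (auto simp: less_imp_neq[symmetric])
  then have "(swept has_vector_derivative 1 / (eta a)\<^sup>2) (at a within {-c..c})"
    unfolding swept_def by (intro interval_integral_FTC2) (auto simp: c_def)
  moreover have "at a within {-c..c} = at a"
    by (rule at_within_interior) (auto simp: c_def)
  ultimately show ?thesis
    by (simp only: has_real_derivative_iff_has_vector_derivative)
qed

lemma swept_strict_mono: "a < b \<Longrightarrow> swept a < swept b"
proof (rule DERIV_pos_imp_increasing[where f = swept])
  show "\<exists>y. DERIV swept x :> y \<and> 0 < y" for x
    using swept_deriv[of x] eta_pos[of x] by (intro exI[of _ "1 / (eta x)\<^sup>2"]) simp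
qed

lemma swept_less_iff: "swept a < swept b \<longleftrightarrow> a < b"
  using swept_strict_mono[of a b] swept_strict_mono[of b a] by (cases a b rule: linorder_cases) auto

lemma swept_inj: "swept a = swept b \<longleftrightarrow> a = b"
  using swept_strict_mono[of a b] swept_strict_mono[of b a] by (cases a b rule: linorder_cases) auto

text \<open>Both sides vanish at 0 and have the same derivative.\<close>

lemma swept_eq_warea:
  assumes "a \<in> {0..2 * pi}"
  shows "swept a = 2 * warea 0 a"
proof -
  have "\<exists>c. \<forall>x\<in>{0..2 * pi}. 2 * warea 0 x - swept x = c"
  proof (rule has_field_derivative_zero_constant)
    fix x assume "x \<in> {0..2 * pi}"
    then show "((\<lambda>x. 2 * warea 0 x - swept x) has_real_derivative 0) (at x within {0..2 * pi})"
      by (auto intro!: derivative_eq_intros warea_deriv has_field_derivative_at_within[OF swept_deriv])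
  qed simp
  then obtain c where c: "\<And>x. x \<in> {0..2 * pi} \<Longrightarrow> 2 * warea 0 x - swept x = c" by blast
  from c[of 0] c[OF assms] show ?thesis by (simp add: warea_refl)
qed

lemma swept_2pi: "swept (2 * pi) = 2 * area (polar D)"
  using swept_eq_warea[of "2 * pi"] by (simp add: warea_full)

lemma area_polar_pos: "0 < area (polar D)"
  using swept_2pi swept_strict_mono[of 0 "2 * pi"] by simp

lemma swept_period: "swept (a + 2 * pi) = swept a + 2 * area (polar D)"
proof -
  have "\<forall>x. DERIV (\<lambda>x. swept (x + 2 * pi) - swept x) x :> 0"
  proof
    fix x
    have "eta (x + 2 * pi) = eta x" using eta_shift[of x 1] by simp
    then have "DERIV (\<lambda>x. swept (x + 2 * pi)) x :> 1 / (eta x)\<^sup>2"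
      using swept_deriv[of "x + 2 * pi"] by (simp add: DERIV_shift)
    then show "DERIV (\<lambda>x. swept (x + 2 * pi) - swept x) x :> 0"
      using swept_deriv[of x] by (auto intro!: derivative_eq_intros)
  qed
  then have "swept (a + 2 * pi) - swept a = swept (0 + 2 * pi) - swept 0" by (rule DERIV_isconst_all)
  then show ?thesis using swept_2pi by simp
qed

lemma swept_shift: "swept (a + 2 * pi * of_int k) = swept a + 2 * area (polar D) * of_int k"
proof -
  have *: "swept (a + 2 * pi * real n) = swept a + 2 * area (polar D) * real n" for a n
  proof (induction n)
    case (Suc n)
    then show ?case using swept_period[of "a + 2 * pi * real n"] by (simp add: algebra_simps)
  qed simp
  show ?thesis
  proof (cases "0 \<le> k")
    case True
    then show ?thesis using *[of a "nat k"] by simp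
  next
    case False
    then show ?thesis using *[of "a + 2 * pi * of_int k" "nat (- k)"] by simp
  qed
qed

text \<open>Adding full turns to the angle adds periods to the swept area, so both reductions
  subtract the same integer \<open>k\<close>. Injectivity of \<open>swept\<close> then identifies
  the angle described by \<open>gangle\<close>.\<close>

lemma gpoint_swept: "gpoint (polar D) (swept a) = (1 / eta a) *\<^sub>R dir a"
proof -
  define k where "k = \<lfloor>a / (2 * pi)\<rfloor>"
  define b where "b = a - 2 * pi * of_int k"
  have "of_int k \<le> a / (2 * pi)" "a / (2 * pi) < of_int k + 1"
    unfolding k_def by linarith+
  then have b: "0 \<le> b" "b < 2 * pi" unfolding b_def by (simp_all add: field_simps)
  define S where "S = 2 * area (polar D)"
  have S: "0 < S" "S = swept (2 * pi)" using area_polar_pos swept_2pi by (auto simp: S_def)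
  have ab: "a = b + 2 * pi * of_int k" by (simp add: b_def)
  have Ga: "swept a = swept b + S * of_int k" unfolding ab swept_shift S_def by simp
  have Gb: "0 \<le> swept b" "swept b < S"
    using swept_less_iff[of b 0] swept_less_iff[of b "2 * pi"] b S by auto
  have "\<lfloor>swept a / S\<rfloor> = k"
  proof -
    have "swept a / S = swept b / S + of_int k" unfolding Ga using S by (simp add: field_simps)
    moreover have "0 \<le> swept b / S" "swept b / S < 1" using Gb S by auto
    ultimately show ?thesis by (simp add: floor_unique)
  qed
  then have red: "swept a - S * of_int \<lfloor>swept a / S\<rfloor> = swept b" using Ga by simp
  have sec: "area (sector (polar D) c) = swept c / 2" if "0 \<le> c" "c < 2 * pi" for c
    using swept_eq_warea[of c] that by (simp add: area_def sector_eq)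
  have "gangle (polar D) (swept b) = b"
    unfolding gangle_def
  proof (rule the_equality)
    show "0 \<le> b \<and> b < 2 * pi \<and> area (sector (polar D) b) = swept b / 2" using b sec by simp
    fix c assume "0 \<le> c \<and> c < 2 * pi \<and> area (sector (polar D) c) = swept b / 2"
    then have "swept c = swept b" using sec[of c] by auto
    then show "c = b" using swept_inj by blast
  qed
  then have "gpoint (polar D) (swept a) = (1 / eta b) *\<^sub>R dir b"
    unfolding gpoint_def Let_def S_def[symmetric] red by (simp add: radial_polar dir_def)
  then show ?thesis unfolding ab by (simp add: eta_shift dir_shift)
qed

text \<open>The derivative of \<open>swept\<close> is at least \<open>1 / R\<^sup>2\<close>. This
  makes \<open>swept\<close> onto and its inverse Lipschitz.\<close>

lemma swept_expand: "\<bar>a - b\<bar> \<le> R\<^sup>2 * \<bar>swept a - swept b\<bar>"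
proof -
  have "b - a \<le> R\<^sup>2 * (swept b - swept a)" if "a < b" for a b
  proof -
    obtain z where z: "swept b - swept a = (b - a) * (1 / (eta z)\<^sup>2)"
      using MVT2[OF \<open>a < b\<close>, of swept "\<lambda>z. 1 / (eta z)\<^sup>2"] swept_deriv by blast
    have "(eta z)\<^sup>2 \<le> R\<^sup>2" using eta_upper eta_pos[of z] by (intro power_mono) auto
    then have "1 \<le> R\<^sup>2 * (1 / (eta z)\<^sup>2)" using eta_pos[of z] by (simp add: field_simps)
    then have "(b - a) * 1 \<le> (b - a) * (R\<^sup>2 * (1 / (eta z)\<^sup>2))"
      using that by (intro mult_left_mono) auto
    then show ?thesis unfolding z by (simp add: mult_ac)
  qed
  note * = this
  show ?thesis
  proof (cases a b rule: linorder_cases)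
    case less
    then show ?thesis using *[of a b] swept_strict_mono[of a b] by (simp add: abs_if)
  next
    case greater
    then show ?thesis using *[of b a] swept_strict_mono[of b a] by (simp add: abs_if)
  qed simp
qed

lemma isCont_swept: "isCont swept x" by (rule DERIV_isCont[OF swept_deriv])

lemma swept_surj: "\<exists>a. swept a = \<psi>"
proof -
  \<comment> \<open>Far enough out for the expansion estimate to give
    \<open>\<bar>swept x\<bar>\<close> and \<open>\<bar>swept (- x)\<bar>\<close> at least the size
    of \<open>\<psi>\<close>.\<close>
  define x where "x = R\<^sup>2 * \<bar>\<psi>\<bar>"
  have x: "0 \<le> x" by (simp add: x_def)
  have R2: "0 < R\<^sup>2" using R_pos by simp
  have "x \<le> R\<^sup>2 * \<bar>swept x\<bar>" "x \<le> R\<^sup>2 * \<bar>swept (- x)\<bar>"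
    using swept_expand[of x 0] swept_expand[of "- x" 0] x by auto
  then have "\<bar>\<psi>\<bar> \<le> \<bar>swept x\<bar>" "\<bar>\<psi>\<bar> \<le> \<bar>swept (- x)\<bar>" unfolding x_def using R2 by auto
  moreover have "0 \<le> swept x" "swept (- x) \<le> 0"
    using swept_less_iff[of x 0] swept_less_iff[of 0 "- x"] x by auto
  ultimately have "swept (- x) \<le> \<psi>" "\<psi> \<le> swept x" by auto
  then have "\<exists>a\<ge>- x. a \<le> x \<and> swept a = \<psi>" by (rule IVT) (use x isCont_swept in auto)
  then show ?thesis by blast
qed

section \<open>The area parametrisation of the polar boundary\<close>

text \<open>A true inverse, since \<open>swept\<close> is a bijection of the line. Unlike
  \<open>gangle\<close> it is not reduced to one turn, so it has no jumps.\<close>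

definition angle_of :: "real \<Rightarrow> real" where "angle_of = inv swept"

lemma swept_angle_of [simp]: "swept (angle_of \<psi>) = \<psi>"
  unfolding angle_of_def using swept_surj by (metis f_inv_into_f rangeI)

lemma angle_of_lipschitz: "\<bar>angle_of \<phi> - angle_of \<psi>\<bar> \<le> R\<^sup>2 * \<bar>\<phi> - \<psi>\<bar>"
  using swept_expand[of "angle_of \<phi>" "angle_of \<psi>"] by simp

lemma angle_of_deriv: "(angle_of has_real_derivative (eta (angle_of \<psi>))\<^sup>2) (at \<psi>)"
proof -
  have "(angle_of has_real_derivative inverse (1 / (eta (angle_of \<psi>))\<^sup>2)) (at \<psi>)"
  proof (rule DERIV_inverse_function)
    show "DERIV swept (angle_of \<psi>) :> 1 / (eta (angle_of \<psi>))\<^sup>2" by (rule swept_deriv)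
    show "\<psi> - 1 < \<psi>" "\<psi> < \<psi> + 1" by auto
    have "(R\<^sup>2)-lipschitz_on UNIV angle_of"
      by (rule lipschitz_onI) (use angle_of_lipschitz in \<open>auto simp: dist_real_def\<close>)
    then have "continuous_on UNIV angle_of" by (rule lipschitz_on_continuous_on)
    then show "isCont angle_of \<psi>" by (simp add: continuous_on_eq_continuous_at)
  qed (use eta_pos[of "angle_of \<psi>"] in auto)
  then show ?thesis by simp
qed

lemma gpoint_eq: "gpoint (polar D) \<psi> = (1 / eta (angle_of \<psi>)) *\<^sub>R dir (angle_of \<psi>)"
  using gpoint_swept[of "angle_of \<psi>"] by simp

lemma gpoint_in_polar: "gpoint (polar D) \<psi> \<in> polar D"
  unfolding gpoint_eq using eta_pos[of "angle_of \<psi>"] by (simp add: ray_in_polar)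

text \<open>The condition on \<open>v\<close> describes the boundary of the polar body, and each
  boundary point lies on a ray at distance \<open>1 / eta t\<close>.\<close>

lemma gpoint_surj:
  assumes "supp v = 1" shows "\<exists>\<psi>. gpoint (polar D) \<psi> = v"
proof -
  obtain t where t: "v = norm v *\<^sub>R dir t" using polar_form by blast
  have "norm v * eta t = 1" using assms supp_scale[of "norm v" "dir t"] t by (simp add: eta_def)
  then have "norm v = 1 / eta t" using eta_pos[of t] by (simp add: field_simps)
  then have "gpoint (polar D) (swept t) = v" using gpoint_swept[of t] t by simp
  then show ?thesis by blast
qed

lemma gpoint_lipschitz: "\<exists>C. C-lipschitz_on UNIV (gpoint (polar D))"
proof -
  \<comment> \<open>The first summand accounts for turning the direction at radius at most
    \<open>1 / r\<close>, the second for the change of the radius \<open>1 / eta\<close>.\<close>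
  define C where "C = 1 / r + R / r\<^sup>2"
  have C: "0 \<le> C" using r_pos R_pos by (simp add: C_def)
  have *: "norm ((1 / eta a) *\<^sub>R dir a - (1 / eta b) *\<^sub>R dir b) \<le> C * \<bar>a - b\<bar>" for a b
  proof -
    have ep: "0 < eta a" "0 < eta b" by (rule eta_pos)+
    have "(1 / eta a) *\<^sub>R dir a - (1 / eta b) *\<^sub>R dir b =
        (1 / eta a) *\<^sub>R (dir a - dir b) + (1 / eta a - 1 / eta b) *\<^sub>R dir b"
      by (simp add: algebra_simps)
    then have "norm ((1 / eta a) *\<^sub>R dir a - (1 / eta b) *\<^sub>R dir b) \<le>
        norm ((1 / eta a) *\<^sub>R (dir a - dir b)) + norm ((1 / eta a - 1 / eta b) *\<^sub>R dir b)"
      by (metis norm_triangle_ineq)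
    also have "\<dots> = (1 / eta a) * norm (dir a - dir b) + \<bar>1 / eta a - 1 / eta b\<bar>"
      using ep by simp
    also have "\<bar>1 / eta a - 1 / eta b\<bar> = \<bar>eta a - eta b\<bar> / (eta a * eta b)"
    proof -
      have "1 / eta a - 1 / eta b = - (eta a - eta b) / (eta a * eta b)" using ep by (simp add: field_simps)
      then show ?thesis using ep by (simp add: abs_mult)
    qed
    also have "\<dots> \<le> (R * \<bar>a - b\<bar>) / (r * r)"
      using eta_lipschitz eta_lower r_pos R_pos ep by (intro frac_le mult_mono) auto
    also have "(1 / eta a) * norm (dir a - dir b) \<le> (1 / r) * \<bar>a - b\<bar>"
      using eta_lower r_pos by (intro mult_mono norm_dir_diff frac_le) auto
    finally show ?thesis by (simp add: C_def power2_eq_square algebra_simps)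
  qed
  have "(C * R\<^sup>2)-lipschitz_on UNIV (gpoint (polar D))"
  proof (rule lipschitz_onI)
    fix \<phi> \<psi> :: real
    have "dist (gpoint (polar D) \<phi>) (gpoint (polar D) \<psi>) \<le> C * \<bar>angle_of \<phi> - angle_of \<psi>\<bar>"
      unfolding gpoint_eq dist_norm by (rule *)
    also have "\<dots> \<le> C * (R\<^sup>2 * \<bar>\<phi> - \<psi>\<bar>)" by (rule mult_left_mono[OF angle_of_lipschitz C])
    finally show "dist (gpoint (polar D) \<phi>) (gpoint (polar D) \<psi>) \<le> C * R\<^sup>2 * dist \<phi> \<psi>"
      by (simp add: dist_real_def)
  qed (use C in auto)
  then show ?thesis by blast
qed

section \<open>Differentiability of the support function and of the parametrisation\<close>

text \<open>The contact set of \<open>D\<close> with its support line of outer normal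
  \<open>dir a\<close>.\<close>

definition maximizers :: "real \<Rightarrow> (real \<times> real) set" where
  "maximizers a = {P \<in> D. P \<bullet> dir a = eta a}"

lemma maximizers_eq_gpoint:
  "maximizers (angle_of \<psi>) = {P \<in> D. P \<bullet> gpoint (polar D) \<psi> = 1}"
  using eta_pos[of "angle_of \<psi>"] by (auto simp: maximizers_def gpoint_eq field_simps)

lemma maximizers_ge: "P \<in> D \<Longrightarrow> P \<bullet> dir a \<le> eta a"
  unfolding eta_def by (rule supp_ge)

text \<open>Danskin's argument. By compactness, maximisers \<open>Q\<close> for angles
  \<open>b\<close> near \<open>a\<close> are close to \<open>P\<close>; then
  \<open>eta b - P \<bullet> dir b\<close> lies between 0 and
  \<open>(Q - P) \<bullet> (dir b - dir a)\<close>, which is of smaller order than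
  \<open>b - a\<close>.\<close>

lemma eta_deriv:
  assumes uniq: "maximizers a = {P}"
  shows "(eta has_real_derivative P \<bullet> dir' a) (at a)"
proof -
  have P: "P \<in> D" "P \<bullet> dir a = eta a" using uniq by (auto simp: maximizers_def)
  have near: "\<exists>d>0. \<forall>b Q. \<bar>b - a\<bar> < d \<and> Q \<in> maximizers b \<longrightarrow> norm (Q - P) < e" if "e > 0" for e
  proof (cases "D - ball P e = {}")
    case True
    then have "norm (Q - P) < e" if "Q \<in> D" for Q
      using that by (auto simp: dist_norm norm_minus_commute)
    then show ?thesis by (auto simp: maximizers_def intro: exI[of _ 1])
  next
    case False
    have "compact (D - ball P e)" using compact_D by (rule compact_diff) simp
    moreover have "continuous_on (D - ball P e) (\<lambda>Q. Q \<bullet> dir a)" by (intro continuous_intros)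
    ultimately obtain Q0 where Q0: "Q0 \<in> D - ball P e"
      "\<And>Q. Q \<in> D - ball P e \<Longrightarrow> Q \<bullet> dir a \<le> Q0 \<bullet> dir a"
      using continuous_attains_sup[OF _ False] by blast
    \<comment> \<open>The gap between the maximum and the best value away from \<open>P\<close>.
      Turning by \<open>b - a\<close> changes \<open>eta\<close> and the value at \<open>Q\<close>
      by at most \<open>R * \<bar>b - a\<bar>\<close> each, hence the radius
      \<open>\<delta> / (2 * R)\<close>.\<close>
    define \<delta> where "\<delta> = eta a - Q0 \<bullet> dir a"
    have "Q0 \<notin> maximizers a" using uniq Q0(1) \<open>e > 0\<close> by auto
    then have "\<delta> > 0" using maximizers_ge[of Q0 a] Q0(1) by (auto simp: \<delta>_def maximizers_def)
    have "norm (Q - P) < e" if b: "\<bar>b - a\<bar> < \<delta> / (2 * R)" and Q: "Q \<in> maximizers b" for b Q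
    proof (rule ccontr)
      assume "\<not> norm (Q - P) < e"
      then have QD: "Q \<in> D - ball P e" using Q by (auto simp: maximizers_def dist_norm norm_minus_commute)
      have "Q \<bullet> dir b - Q \<bullet> dir a = Q \<bullet> (dir b - dir a)" by (simp add: inner_diff_right)
      also have "\<dots> \<le> norm Q * norm (dir b - dir a)" by (rule norm_cauchy_schwarz)
      also have "\<dots> \<le> R * \<bar>b - a\<bar>" using QD norm_D R_pos by (intro mult_mono norm_dir_diff) auto
      finally have 1: "Q \<bullet> dir b - Q \<bullet> dir a \<le> R * \<bar>b - a\<bar>" .
      have 2: "Q \<bullet> dir a \<le> eta a - \<delta>" using Q0(2)[OF QD] by (simp add: \<delta>_def)
      have 3: "eta a - eta b \<le> R * \<bar>b - a\<bar>" using eta_lipschitz[of a b] by (simp add: abs_minus_commute)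
      have 4: "Q \<bullet> dir b = eta b" using Q by (simp add: maximizers_def)
      have "\<delta> \<le> 2 * (R * \<bar>b - a\<bar>)" using 1 2 3 4 by linarith
      moreover have "2 * (R * \<bar>b - a\<bar>) < \<delta>" using b R_pos by (simp add: field_simps)
      ultimately show False by simp
    qed
    then show ?thesis using \<open>\<delta> > 0\<close> R_pos by (intro exI[of _ "\<delta> / (2 * R)"]) auto
  qed
  have lin: "((\<lambda>b. P \<bullet> dir b) has_real_derivative P \<bullet> dir' a) (at a)"
    unfolding dir_def dir'_def inner_prod_def by (auto intro!: derivative_eq_intros)
  have "((\<lambda>b. eta b - P \<bullet> dir b) has_derivative (\<lambda>h. 0)) (at a)"
    unfolding has_derivative_within_alt
  proof (intro conjI allI impI)
    fix e :: real assume "e > 0"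
    then obtain d where d: "d > 0" "\<And>b Q. \<bar>b - a\<bar> < d \<Longrightarrow> Q \<in> maximizers b \<Longrightarrow> norm (Q - P) < e"
      using near by blast
    have "norm (eta b - P \<bullet> dir b - (eta a - P \<bullet> dir a) - 0) \<le> e * norm (b - a)" if "norm (b - a) < d" for b
    proof -
      obtain Q where Q: "Q \<in> D" "Q \<bullet> dir b = eta b" unfolding eta_def using supp_attained by blast
      have "0 \<le> eta b - P \<bullet> dir b" using maximizers_ge[OF P(1)] by simp
      moreover have "eta b - P \<bullet> dir b \<le> (Q - P) \<bullet> (dir b - dir a)"
        using maximizers_ge[OF Q(1), of a] Q(2) P(2) by (simp add: inner_diff_left inner_diff_right)
      moreover have "(Q - P) \<bullet> (dir b - dir a) \<le> norm (Q - P) * norm (dir b - dir a)"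
        by (rule norm_cauchy_schwarz)
      moreover have "norm (Q - P) * norm (dir b - dir a) \<le> e * \<bar>b - a\<bar>"
        using d(2)[of b Q] that Q \<open>e > 0\<close>
        by (intro mult_mono norm_dir_diff) (auto simp: maximizers_def)
      ultimately show ?thesis using P(2) by simp
    qed
    then show "\<exists>d>0. \<forall>b\<in>UNIV. norm (b - a) < d \<longrightarrow>
        norm (eta b - P \<bullet> dir b - (eta a - P \<bullet> dir a) - 0) \<le> e * norm (b - a)"
      using d(1) by blast
  qed auto
  then have "((\<lambda>b. eta b - P \<bullet> dir b) has_real_derivative 0) (at a)"
    by (simp add: has_field_derivative_def lambda_zero)
  from DERIV_add[OF this lin] show ?thesis by simp
qed

text \<open>A direction with several maximisers has a contact set of positive extent along a fixed
  axis. A rational number strictly inside each extent gives an injection into the rationals, first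
  for angles in a short window and then for the line as a countable union of windows.\<close>

lemma countable_nonunique_maximizers:
  "countable {a. \<exists>P\<in>maximizers a. \<exists>Q\<in>maximizers a. P \<noteq> Q}" (is "countable ?N")
proof -
  have loc: "countable (?N \<inter> {c - 1..c + 1})" for c
  proof -
    \<comment> \<open>In a window of half-width 1 the cosines of \<open>a - c\<close> and the sines
      of differences \<open>b - a\<close> with \<open>a < b\<close> are positive, because
      \<open>1 < pi / 2\<close> and \<open>2 < pi\<close>.\<close>
    define M where "M = ?N \<inter> {c - 1..c + 1}"
    have M: "\<exists>P\<in>maximizers a. \<exists>Q\<in>maximizers a. P \<noteq> Q" "a \<in> {c - 1..c + 1}" if "a \<in> M" for a
      using that unfolding M_def by blast+
    define sep where "sep a x \<longleftrightarrow>
      (\<exists>P\<in>maximizers a. \<exists>Q\<in>maximizers a. P \<bullet> dir' c < x \<and> x < Q \<bullet> dir' c)" for a x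
    \<comment> \<open>The \<open>dir' c\<close>-extents of the faces in directions near \<open>c\<close> are non-overlapping intervals.\<close>
    have ex: "\<exists>q::rat. sep a (of_rat q)"
      if a: "a \<in> M" for a
    proof -
      obtain P Q where PQ: "P \<in> maximizers a" "Q \<in> maximizers a" "P \<noteq> Q" using M(1)[OF a] by blast
      have "P \<bullet> dir' c \<noteq> Q \<bullet> dir' c"
      proof
        assume eq: "P \<bullet> dir' c = Q \<bullet> dir' c"
        define X where "X = P - Q"
        have 1: "X \<bullet> dir a = 0" "X \<bullet> dir' c = 0"
          using PQ eq by (auto simp: X_def maximizers_def inner_diff_left)
        have cp: "0 < cos (a - c)" using M(2)[OF a] pi_gt3 by (intro cos_gt_zero_pi) auto
        \<comment> \<open>Cramer's rule for recovering \<open>X\<close> from its products with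
          \<open>dir a\<close> and \<open>dir' c\<close>; the determinant is
          \<open>cos (a - c)\<close>.\<close>
        have "fst X * cos (a - c) = cos c * (X \<bullet> dir a) - sin a * (X \<bullet> dir' c)"
             "snd X * cos (a - c) = sin c * (X \<bullet> dir a) + cos a * (X \<bullet> dir' c)"
          by (auto simp: dir_def dir'_def inner_prod_def cos_diff algebra_simps)
        then have "X = 0" using 1 cp by (simp add: prod_eq_iff)
        then show False using PQ(3) by (simp add: X_def)
      qed
      then consider "P \<bullet> dir' c < Q \<bullet> dir' c" | "Q \<bullet> dir' c < P \<bullet> dir' c" by linarith
      then show ?thesis
      proof cases
        case 1
        then show ?thesis using of_rat_dense[OF 1] PQ(1,2) unfolding sep_def by blast
      next
        case 2
        then show ?thesis using of_rat_dense[OF 2] PQ(1,2) unfolding sep_def by blast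
      qed
    qed
    then have "\<forall>a\<in>M. \<exists>q::rat. sep a (of_rat q)" by blast
    then obtain q :: "real \<Rightarrow> rat" where q: "\<forall>a\<in>M. sep a (of_rat (q a))"
      using bchoice[of M "\<lambda>a q. sep a (of_rat q)"] by blast
    have mono: "P \<bullet> dir' c \<le> Q \<bullet> dir' c"
      if "P \<in> maximizers a" "Q \<in> maximizers b" "a < b" "a \<in> {c - 1..c + 1}" "b \<in> {c - 1..c + 1}" for a b P Q
    proof -
      define X where "X = P - Q"
      have 1: "0 \<le> X \<bullet> dir a" "X \<bullet> dir b \<le> 0"
        using that maximizers_ge[of P b] maximizers_ge[of Q a]
        by (auto simp: X_def maximizers_def inner_diff_left)
      have cp: "0 < cos (a - c)" "0 < cos (b - c)" using that pi_gt3 by (auto intro!: cos_gt_zero_pi)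
      have sp: "0 < sin (b - a)" using that pi_gt3 by (intro sin_gt_zero) auto
      \<comment> \<open>Expresses \<open>dir' c\<close> through \<open>dir a\<close> and
        \<open>dir b\<close>, so that the signs of \<open>X \<bullet> dir a\<close> and
        \<open>X \<bullet> dir b\<close> decide that of \<open>X \<bullet> dir' c\<close>.\<close>
      have "sin (b - a) * (X \<bullet> dir' c) = cos (a - c) * (X \<bullet> dir b) - cos (b - c) * (X \<bullet> dir a)"
        by (simp add: dir_def dir'_def inner_prod_def cos_diff sin_diff algebra_simps)
      also have "\<dots> \<le> 0"
        using mult_nonneg_nonpos[of "cos (a - c)" "X \<bullet> dir b"]
          mult_nonneg_nonneg[of "cos (b - c)" "X \<bullet> dir a"] 1 cp by linarith
      finally have "X \<bullet> dir' c \<le> 0" using sp by (simp add: mult_le_0_iff)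
      then show ?thesis by (simp add: X_def inner_diff_left)
    qed
    have "inj_on q M"
    proof (rule inj_onI)
      have less: False if ab: "a \<in> M" "b \<in> M" "q a = q b" "a < b" for a b
      proof -
        obtain P where P: "P \<in> maximizers a" "of_rat (q a) < P \<bullet> dir' c" using bspec[OF q ab(1)] unfolding sep_def by blast
        obtain Q where Q: "Q \<in> maximizers b" "Q \<bullet> dir' c < of_rat (q b)" using bspec[OF q ab(2)] unfolding sep_def by blast
        have "P \<bullet> dir' c \<le> Q \<bullet> dir' c" by (rule mono[OF P(1) Q(1) \<open>a < b\<close> M(2)[OF that(1)] M(2)[OF that(2)]])
        then show False using P(2) Q(2) \<open>q a = q b\<close> by simp
      qed
      fix a b assume "a \<in> M" "b \<in> M" "q a = q b"
      then show "a = b" using less[of a b] less[of b a] by (cases a b rule: linorder_cases) simp_all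
    qed
    then have "countable M" by (rule countable_image_inj_on[rotated]) simp
    then show ?thesis unfolding M_def .
  qed
  have "?N \<subseteq> (\<Union>k::int. ?N \<inter> {of_int k - 1..of_int k + 1})"
  proof
    fix a assume "a \<in> ?N"
    moreover have "a \<in> {of_int \<lfloor>a\<rfloor> - 1..of_int \<lfloor>a\<rfloor> + 1}" by (simp; linarith)
    ultimately show "a \<in> (\<Union>k::int. ?N \<inter> {of_int k - 1..of_int k + 1})" by blast
  qed
  moreover have "countable (\<Union>k::int. ?N \<inter> {of_int k - 1..of_int k + 1})"
    by (intro countable_UN loc) simp
  ultimately show ?thesis by (rule countable_subset)
qed

text \<open>The factor \<open>(eta a)\<^sup>2\<close> from \<open>angle_of\<close> cancels the
  denominator of the quotient rule. What remains is \<open>(P \<bullet> dir a) *\<^sub>R dir' a - (P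
  \<bullet> dir' a) *\<^sub>R dir a\<close>, which is \<open>P\<close> turned by a right
  angle.\<close>

lemma gpoint_deriv:
  assumes uniq: "maximizers (angle_of \<psi>) = {P}"
  shows "((\<lambda>\<psi>. gcos (polar D) \<psi>) has_real_derivative - snd P) (at \<psi>)"
    and "((\<lambda>\<psi>. gsin (polar D) \<psi>) has_real_derivative fst P) (at \<psi>)"
proof -
  define a where "a = angle_of \<psi>"
  have ep: "eta a \<noteq> 0" using eta_pos[of a] by simp
  have P: "eta a = fst P * cos a + snd P * sin a"
    using uniq unfolding a_def maximizers_def dir_def inner_prod_def by force
  have dang: "((\<lambda>\<psi>. angle_of \<psi>) has_real_derivative (eta a)\<^sup>2) (at \<psi>)" unfolding a_def by (rule angle_of_deriv)
  have deta: "((\<lambda>\<psi>. eta (angle_of \<psi>)) has_real_derivative (P \<bullet> dir' a) * (eta a)\<^sup>2) (at \<psi>)"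
    by (rule DERIV_chain2[of eta _ angle_of]) (use eta_deriv[OF uniq] dang a_def in auto)
  have dc: "((\<lambda>\<psi>. cos (angle_of \<psi>)) has_real_derivative - sin a * (eta a)\<^sup>2) (at \<psi>)"
    using dang by (auto intro!: derivative_eq_intros simp: a_def)
  have ds: "((\<lambda>\<psi>. sin (angle_of \<psi>)) has_real_derivative cos a * (eta a)\<^sup>2) (at \<psi>)"
    using dang by (auto intro!: derivative_eq_intros simp: a_def)
  have "((\<lambda>\<psi>. cos (angle_of \<psi>) / eta (angle_of \<psi>)) has_real_derivative
     (- sin a * (eta a)\<^sup>2 * eta a - cos a * ((P \<bullet> dir' a) * (eta a)\<^sup>2)) / (eta a * eta a)) (at \<psi>)"
    using DERIV_divide[OF dc deta] ep by (simp add: a_def)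
  also have "(- sin a * (eta a)\<^sup>2 * eta a - cos a * ((P \<bullet> dir' a) * (eta a)\<^sup>2)) / (eta a * eta a)
      = - sin a * eta a - cos a * (P \<bullet> dir' a)"
    using ep by (simp add: power2_eq_square field_simps)
  \<comment> \<open>After inserting \<open>eta a = P \<bullet> dir a\<close> the terms with
    \<open>fst P\<close> cancel. Removing the Pythagorean simplification rules leaves a plain
    polynomial identity.\<close>
  also have "\<dots> = - snd P * (cos a * cos a + sin a * sin a)"
    unfolding P dir'_def inner_prod_def
    by (simp add: algebra_simps del: sin_cos_squared_add sin_cos_squared_add2 sin_cos_squared_add3)
  also have "\<dots> = - snd P" by (simp only: sin_cos_squared_add3 mult_1_right)
  finally show "((\<lambda>\<psi>. gcos (polar D) \<psi>) has_real_derivative - snd P) (at \<psi>)"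
    by (simp add: gcos_def gpoint_eq dir_def)
  have "((\<lambda>\<psi>. sin (angle_of \<psi>) / eta (angle_of \<psi>)) has_real_derivative
     (cos a * (eta a)\<^sup>2 * eta a - sin a * ((P \<bullet> dir' a) * (eta a)\<^sup>2)) / (eta a * eta a)) (at \<psi>)"
    using DERIV_divide[OF ds deta] ep by (simp add: a_def)
  also have "(cos a * (eta a)\<^sup>2 * eta a - sin a * ((P \<bullet> dir' a) * (eta a)\<^sup>2)) / (eta a * eta a)
      = cos a * eta a - sin a * (P \<bullet> dir' a)"
    using ep by (simp add: power2_eq_square field_simps)
  also have "\<dots> = fst P * (cos a * cos a + sin a * sin a)"
    unfolding P dir'_def inner_prod_def
    by (simp add: algebra_simps del: sin_cos_squared_add sin_cos_squared_add2 sin_cos_squared_add3)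
  also have "\<dots> = fst P" by (simp only: sin_cos_squared_add3 mult_1_right)
  finally show "((\<lambda>\<psi>. gsin (polar D) \<psi>) has_real_derivative fst P) (at \<psi>)"
    by (simp add: gsin_def gpoint_eq dir_def)
qed

end

section \<open>The energy integral\<close>

text \<open>Supplies the two analytic lemmas with their hypotheses: the correspondence
  \<open>corr\<close> is read as maximality, so that uniqueness of the maximiser gives both a
  singleton and a derivative.\<close>

lemma potential_regularity:
  fixes \<Omega> :: "(real \<times> real) set" and f fp fq :: "real \<times> real \<Rightarrow> real"
  assumes conv: "convex \<Omega>" and comp: "compact \<Omega>" and int: "(0, 0) \<in> interior \<Omega>"
    and df: "\<And>z. (f has_derivative (\<lambda>h. fp z * fst h + fq z * snd h)) (at z)"
    and cp: "continuous_on UNIV fp" and cq: "continuous_on UNIV fq"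
  obtains M N where "M-lipschitz_on UNIV (Upot \<Omega> f)" and "countable N"
    and "\<And>\<psi>. \<psi> \<notin> N \<Longrightarrow> \<exists>d. Uder \<Omega> fp fq \<psi> = {d} \<and> (Upot \<Omega> f has_real_derivative d) (at \<psi>)"
proof -
  obtain r where r: "0 < r" "cball 0 r \<subseteq> \<Omega>"
    using int mem_interior_cball[of "(0, 0)" \<Omega>] by (auto simp: zero_prod_def)
  obtain R where R: "\<And>x. x \<in> \<Omega> \<Longrightarrow> norm x \<le> R"
    using compact_imp_bounded[OF comp] by (auto simp: bounded_iff)
  interpret B: body_around_0 \<Omega> r R
    using comp r R by unfold_locales auto
  \<comment> \<open>The second instance describes \<open>gpoint \<Omega>\<close>, because \<Omega>
    is the polar of \<open>polar \<Omega>\<close> by \<open>pp\<close>.\<close>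
  interpret P: body_around_0 "polar \<Omega>" "1 / R" "1 / r" by (rule B.body_around_0_polar)
  have pp: "polar (polar \<Omega>) = \<Omega>" by (rule B.polar_polar[OF conv])
  define Q where "Q = gpoint (polar \<Omega>)"
  have U: "Upot \<Omega> f = (\<lambda>\<psi>. f (Q \<psi>))"
    by (simp add: Upot_def Q_def gcos_def gsin_def fun_eq_iff)
  have inn: "gcos \<Omega> \<theta> * gcos (polar \<Omega>) \<psi> + gsin \<Omega> \<theta> * gsin (polar \<Omega>) \<psi> = gpoint \<Omega> \<theta> \<bullet> Q \<psi>" for \<theta> \<psi>
    by (simp add: gcos_def gsin_def Q_def inner_prod_def)
  have dual: "{gpoint \<Omega> \<theta> | \<theta>. corr \<Omega> \<theta> \<psi>} = B.maximizers (B.angle_of \<psi>)" for \<psi>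
  proof (intro set_eqI iffI)
    fix p assume "p \<in> {gpoint \<Omega> \<theta> | \<theta>. corr \<Omega> \<theta> \<psi>}"
    then obtain \<theta> where \<theta>: "p = gpoint \<Omega> \<theta>" "corr \<Omega> \<theta> \<psi>" by blast
    have "p \<in> \<Omega>" using P.gpoint_in_polar[of \<theta>] \<theta>(1) by (simp add: pp)
    then show "p \<in> B.maximizers (B.angle_of \<psi>)"
      using \<theta> unfolding B.maximizers_eq_gpoint corr_def inn Q_def by simp
  next
    fix p assume "p \<in> B.maximizers (B.angle_of \<psi>)"
    then have p: "p \<in> \<Omega>" "p \<bullet> Q \<psi> = 1" unfolding B.maximizers_eq_gpoint Q_def by auto
    \<comment> \<open>A maximiser must be shown to lie on the boundary of \<Omega>, where
      \<open>gpoint \<Omega>\<close> reaches it: \<open>p \<in> \<Omega>\<close> bounds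
      \<open>P.supp p\<close> above by 1, and \<open>Q \<psi>\<close> attains that value.\<close>
    have "P.supp p \<le> 1" unfolding P.supp_le_iff using p(1) B.polar_iff by (metis inner_commute)
    moreover have "Q \<psi> \<bullet> p \<le> P.supp p" unfolding Q_def by (rule P.supp_ge[OF B.gpoint_in_polar])
    ultimately have "P.supp p = 1" using p(2) by (simp add: inner_commute)
    then obtain \<theta> where "gpoint \<Omega> \<theta> = p" using P.gpoint_surj pp by metis
    then show "p \<in> {gpoint \<Omega> \<theta> | \<theta>. corr \<Omega> \<theta> \<psi>}"
      using p(2) unfolding corr_def inn by blast
  qed
  have Ud: "Uder \<Omega> fp fq \<psi> = (\<lambda>p. - fp (Q \<psi>) * snd p + fq (Q \<psi>) * fst p) ` B.maximizers (B.angle_of \<psi>)" for \<psi>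
    unfolding dual[symmetric] Uder_def Let_def
    by (auto simp add: Q_def gcos_def gsin_def simp del: mult_minus_left)

  obtain C where C: "C-lipschitz_on UNIV Q" using B.gpoint_lipschitz unfolding Q_def by blast
  have bdd: "\<exists>b>0. \<forall>z\<in>polar \<Omega>. \<bar>g z\<bar> \<le> b" if "continuous_on UNIV g" for g :: "real \<times> real \<Rightarrow> real"
  proof -
    have "continuous_on (polar \<Omega>) g" using that continuous_on_subset by blast
    then have "bounded (g ` polar \<Omega>)" by (intro compact_imp_bounded compact_continuous_image B.compact_polar)
    then show ?thesis unfolding bounded_pos by auto
  qed
  obtain b1 where b1: "b1 > 0" "\<And>z. z \<in> polar \<Omega> \<Longrightarrow> \<bar>fp z\<bar> \<le> b1" using bdd[OF cp] by blast
  obtain b2 where b2: "b2 > 0" "\<And>z. z \<in> polar \<Omega> \<Longrightarrow> \<bar>fq z\<bar> \<le> b2" using bdd[OF cq] by blast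
  \<comment> \<open>The gradient is bounded only on compact sets, but the curve \<open>Q\<close>
    stays in the compact convex \<open>polar \<Omega>\<close>.\<close>
  have lipf: "(b1 + b2)-lipschitz_on (polar \<Omega>) f"
  proof (rule bounded_derivative_imp_lipschitz)
    fix z assume z: "z \<in> polar \<Omega>"
    show "(f has_derivative (\<lambda>h. fp z * fst h + fq z * snd h)) (at z within polar \<Omega>)"
      using df by (rule has_derivative_at_withinI)
    show "onorm (\<lambda>h. fp z * fst h + fq z * snd h) \<le> b1 + b2"
    proof (rule onorm_le)
      fix h :: "real \<times> real"
      have "norm (fp z * fst h + fq z * snd h) \<le> \<bar>fp z\<bar> * \<bar>fst h\<bar> + \<bar>fq z\<bar> * \<bar>snd h\<bar>"
        by (metis abs_mult abs_triangle_ineq real_norm_def)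
      also have "\<dots> \<le> b1 * norm h + b2 * norm h"
        using b1 b2 z norm_fst_le[of "fst h" "snd h"] norm_snd_le[of "snd h" "fst h"]
        by (intro add_mono mult_mono) auto
      finally show "norm (fp z * fst h + fq z * snd h) \<le> (b1 + b2) * norm h"
        by (simp add: algebra_simps)
    qed
  qed (use b1 b2 B.convex_polar in auto)
  have "range Q \<subseteq> polar \<Omega>" using B.gpoint_in_polar by (auto simp: Q_def)
  then have "((b1 + b2) * C)-lipschitz_on UNIV (\<lambda>\<psi>. f (Q \<psi>))"
    by (rule lipschitz_on_compose2[OF C lipschitz_on_subset[OF lipf]])
  then have L: "((b1 + b2) * C)-lipschitz_on UNIV (Upot \<Omega> f)" by (simp only: U)

  \<comment> \<open>Translates the exceptional angles into the area parameter through
    \<open>swept\<close>.\<close>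
  define N where "N = B.swept ` {a. \<exists>p\<in>B.maximizers a. \<exists>q\<in>B.maximizers a. p \<noteq> q}"
  have N: "countable N"
    unfolding N_def by (intro countable_image B.countable_nonunique_maximizers)
  have D: "\<exists>d. Uder \<Omega> fp fq \<psi> = {d} \<and> (Upot \<Omega> f has_real_derivative d) (at \<psi>)" if "\<psi> \<notin> N" for \<psi>
  proof -
    obtain p where "p \<in> B.maximizers (B.angle_of \<psi>)"
      unfolding B.maximizers_def B.eta_def using B.supp_attained by blast
    moreover have "\<not> (\<exists>p\<in>B.maximizers (B.angle_of \<psi>). \<exists>q\<in>B.maximizers (B.angle_of \<psi>). p \<noteq> q)"
    proof
      assume "\<exists>p\<in>B.maximizers (B.angle_of \<psi>). \<exists>q\<in>B.maximizers (B.angle_of \<psi>). p \<noteq> q"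
      then have "B.swept (B.angle_of \<psi>) \<in> N" unfolding N_def by blast
      then show False using that by simp
    qed
    ultimately have uniq: "B.maximizers (B.angle_of \<psi>) = {p}" by blast
    let ?d = "- fp (Q \<psi>) * snd p + fq (Q \<psi>) * fst p"
    have "Uder \<Omega> fp fq \<psi> = {?d}" unfolding Ud uniq by simp
    moreover have "(Upot \<Omega> f has_real_derivative ?d) (at \<psi>)"
    proof -
      have "(Q has_derivative (\<lambda>h. (- snd p * h, fst p * h))) (at \<psi>)"
      proof -
        have "Q = (\<lambda>\<psi>. (gcos (polar \<Omega>) \<psi>, gsin (polar \<Omega>) \<psi>))"
          by (simp add: Q_def gcos_def gsin_def)
        then show ?thesis
          using has_derivative_Pair[OF B.gpoint_deriv(1)[OF uniq, unfolded has_field_derivative_def]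
              B.gpoint_deriv(2)[OF uniq, unfolded has_field_derivative_def]] by simp
      qed
      from has_derivative_compose[OF this df[of "Q \<psi>"]]
      have "((\<lambda>\<psi>. f (Q \<psi>)) has_derivative (\<lambda>h. ?d * h)) (at \<psi>)"
        by (simp add: algebra_simps)
      then show ?thesis unfolding U has_field_derivative_def .
    qed
    ultimately show ?thesis by blast
  qed
  show thesis by (rule that[OF L N D])
qed

theorem theorem2:
  fixes \<Omega> :: "(real \<times> real) set"
    and f fp fq :: "real \<times> real \<Rightarrow> real"
  assumes "convex \<Omega>" and "compact \<Omega>" and "(0, 0) \<in> interior \<Omega>"
    and "\<And>z. (f has_derivative (\<lambda>h. fp z * fst h + fq z * snd h)) (at z)"
    and "continuous_on UNIV fp" and "continuous_on UNIV fq"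
  shows
    "(\<forall>I x x'. is_interval I \<and> is_solution \<Omega> fp fq I x \<and>
         (\<forall>t\<in>I. (x has_real_derivative x' t) (at t within I)) \<longrightarrow>
         (\<exists>c. \<forall>t\<in>I. (x' t)\<^sup>2 / 2 + Upot \<Omega> f (x t) = c))
     \<and>
     (\<forall>I y y'. is_interval I \<and>
         (\<forall>t\<in>I. (y has_real_derivative y' t) (at t within I)) \<and> continuous_on I y' \<and>
         (\<forall>t\<in>I. y' t \<noteq> 0) \<and>
         (\<exists>c. \<forall>t\<in>I. (y' t)\<^sup>2 / 2 + Upot \<Omega> f (y t) = c) \<longrightarrow>
         W2inf_on I y \<and> is_solution \<Omega> fp fq I y)"
proof -
  obtain M N where U: "M-lipschitz_on UNIV (Upot \<Omega> f)" "countable N"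
    and D: "\<And>\<psi>. \<psi> \<notin> N \<Longrightarrow> \<exists>d. Uder \<Omega> fp fq \<psi> = {d} \<and> (Upot \<Omega> f has_real_derivative d) (at \<psi>)"
    using potential_regularity[OF assms] by blast
  have first: "\<exists>c. \<forall>t\<in>I. (x' t)\<^sup>2 / 2 + Upot \<Omega> f (x t) = c"
    if I: "is_interval I" and sol: "is_solution \<Omega> fp fq I x"
      and x': "\<forall>t\<in>I. (x has_real_derivative x' t) (at t within I)" for I x x'
  proof (cases "\<exists>s. I \<subseteq> {s}")
    \<comment> \<open>With at most one point in \<open>I\<close> the derivative is not unique, but
      the energy takes at most one value.\<close>
    case True
    then show ?thesis by blast
  next
    case False
    obtain z L where z: "\<forall>t\<in>I. (x has_real_derivative z t) (at t within I)" "L-lipschitz_on I z"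
      and ae: "AE t in lebesgue. t \<in> I \<longrightarrow>
           (\<exists>a. (z has_real_derivative a) (at t within I) \<and> a \<in> uminus ` Uder \<Omega> fp fq (x t))"
      using sol unfolding is_solution_def by blast
    have "x' t = z t" if "t \<in> I" for t
    \<comment> \<open>The given derivative \<open>x'\<close> and the witness \<open>z\<close> from
      \<open>is_solution\<close> agree, as a nondegenerate interval has no isolated points.\<close>
    proof -
      have "t islimpt I"
        using is_interval_connected_1[of I] I False that
        by (intro connected_imp_perfect) auto
      then have "at t within I \<noteq> bot" by (simp add: trivial_limit_within)
      then show ?thesis
        using tendsto_unique bspec[OF x' that] bspec[OF z(1) that]
        unfolding has_field_derivative_iff by blast
    qed
    moreover obtain c where "\<forall>t\<in>I. (z t)\<^sup>2 / 2 + Upot \<Omega> f (x t) = c"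
      using energy_constant[OF U D I _ z(2) ae] z(1) by blast
    ultimately show ?thesis by auto
  qed
  have second: "W2inf_on I y \<and> is_solution \<Omega> fp fq I y"
    if "is_interval I" "\<forall>t\<in>I. (y has_real_derivative y' t) (at t within I)" "continuous_on I y'"
      "\<forall>t\<in>I. y' t \<noteq> 0" "\<forall>t\<in>I. (y' t)\<^sup>2 / 2 + Upot \<Omega> f (y t) = c" for I y y' c
  proof -
    note sol = energy_constant_imp_solution[OF U D that(1) bspec[OF that(2)] that(3)
        bspec[OF that(4)] bspec[OF that(5)]]
    show ?thesis unfolding W2inf_on_def is_solution_def using that(2) sol by blast
  qed
  show ?thesis
    by (rule conjI; intro allI impI; elim conjE exE) (rule first second; assumption)+
qed

end
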